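(* Let $M$ be the real $6$-dimensional nilmanifold underlying the Iwasawa manifold, with left-invariant coframe $e^1,\dots,e^6$ satisfying $de^1=de^2=de^3=de^4=0$, $de^5=e^{13}-e^{24}$, $de^6=e^{14}+e^{23}$. For $t\in[0,1]$ let $J_t$ be the left-invariant almost-complex structure on $M$ whose bundle of $(1,0)$-forms is spanned by $$\varphi_t^1=e^1+i\,e^2,\quad \varphi_t^2=e^3+i\left(\cos(\pi t)\,e^4+\sin(\pi t)\,e^6\right),\quad \varphi_t^3=e^5-i\left(\sin(\pi t)\,e^4-\cos(\pi t)\,e^6\right).$$ Then, for every $t\in(0,1)$, $J_t$ is not complex-$\mathcal{C}^\infty$-full at the first stage in the sense of Li and Zhang; consequently, $J_t$ is not $\mathcal{C}^\infty$-pure-and-full as a generalized-almost-complex structure.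
   Context: $M=\Gamma\backslash G$, where $G$ is the real Lie group underlying the complex $3$-dimensional Heisenberg group $\mathbb{H}(3;\mathbb{C})$ of upper triangular unipotent $3\times3$ complex matrices, and $\Gamma=\mathbb{H}(3;\mathbb{C})\cap \mathrm{GL}(3;\mathbb{Z}[i])$. The coframe $\{e^k\}$ consists of left-invariant real $1$-forms on $G$ descended to $M$, with dual frame $\{e_k\}$; $e^{ij}:=e^i\wedge e^j$. Equivalently, $J_t\in\mathrm{End}(TM)$ is given by $J_te_1=e_2$, $J_te_2=-e_1$, $J_te_3=\cos(\pi t)e_4+\sin(\pi t)e_6$, $J_te_4=-\cos(\pi t)e_3+\sin(\pi t)e_5$, $J_te_5=-\sin(\pi t)e_4+\cos(\pi t)e_6$, $J_te_6=-\sin(\pi t)e_3-\cos(\pi t)e_5$. ($J_0$ is the holomorphically-parallelizable complex structure of the Iwasawa manifold, and $J_1$ is an Abelian complex structure, so that $\{J_t\}$ is a path joining them.) For an almost-complex structure $J$ on a compact manifold $X$ and $(p,q)\in\mathbb{Z}^2$, $H^{(p,q)}_J(X):=\{[\alpha]\in H^{p+q}_{dR}(X;\mathbb{C}) : \alpha\in\wedge^{p,q}_JX\}$ (classes admitting a $d$-closed representative of pure type $(p,q)$). $J$ is complex-$\mathcal{C}^\infty$-full at the $k$th stage in the sense of Li and Zhang if $\sum_{p+q=k}H^{(p,q)}_J(X)=H^k_{dR}(X;\mathbb{C})$. Generalized structures: a generalized-almost-complex structure on a $2n$-dimensional manifold $X$ is an endomorphism $\mathcal{J}$ of $TX\oplus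 T^*X$, orthogonal for $\langle X+\xi\,|\,Y+\eta\rangle:=\frac12(\xi(Y)+\eta(X))$, with $\mathcal{J}^2=-\mathrm{id}$. An almost-complex structure $J$ is viewed as the generalized-almost-complex structure $\mathcal{J}_J:=\begin{pmatrix}-J&0\\0&J^*\end{pmatrix}$, with $J^*$ the dual endomorphism. With $L$ the $i$-eigenbundle of $\mathcal{J}$ and $U\subset\wedge^\bullet X\otimes\mathbb{C}$ the line sub-bundle of forms annihilated exactly by $L$ under the Clifford action $(X+\xi)\cdot\varphi:=\iota_X\varphi+\xi\wedge\varphi$, one sets $U^k:=\wedge^{n-k}\bar L\cdot U$; for $\mathcal{J}=\mathcal{J}_J$ this is $U^k=\bigoplus_{p-q=k}\wedge^{p,q}_JX$. $GH_{dR}(X):=\ker d/\operatorname{im} d$ is the total complex de Rham cohomology, and $GH^{(k)}_{\mathcal{J}}(X)\subseteq GH_{dR}(X)$ is the subspace of classes admitting a $d$-closed representative in $U^k$. $\mathcal{J}$ is $\mathcal{C}^\infty$-pure-and-full if the sum of these subspaces is direct and equals everything: $\bigoplus_{k\in\mathbb{Z}}GH^{(k)}_{\mathcal{J}}(X)=GH_{dR}(X)$. *)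

theory Defs
  imports "HOL-Analysis.Analysis"
begin

text \<open>
  All manifolds below are quotients \<open>X = V/D\<close> of a Euclidean space \<open>V\<close> by a group \<open>D\<close> of
  diffeomorphisms acting freely and properly discontinuously, given as a set of maps \<open>V \<Rightarrow> V\<close>.
  Pull-back along the covering \<open>V \<rightarrow> X\<close> identifies tensor fields and differential forms on \<open>X\<close>
  with the \<open>D\<close>-invariant ones on \<open>V\<close>; this is how they are represented here.
\<close>

section \<open>Smooth maps\<close>

fun C_k :: "nat \<Rightarrow> ('a::euclidean_space \<Rightarrow> 'b::real_normed_vector) \<Rightarrow> bool" where
  "C_k 0 f \<longleftrightarrow> continuous_on UNIV f"
| "C_k (Suc n) f \<longleftrightarrow> (\<forall>x. f differentiable (at x)) \<and>
     (\<forall>v. C_k n (\<lambda>x. frechet_derivative f (at x) v))"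

definition smooth :: "('a::euclidean_space \<Rightarrow> 'b::real_normed_vector) \<Rightarrow> bool" where
  "smooth f \<longleftrightarrow> (\<forall>n. C_k n f)"

section \<open>Complex exterior algebra of the dual of a real vector space\<close>

text \<open>
  An element of \<open>\<Lambda>\<^sup>\<bullet>V\<^sup>* \<otimes> \<complex>\<close> is a function on lists of vectors; its restriction to the lists of
  length \<open>k\<close> is its component of degree \<open>k\<close>, an alternating real-multilinear map \<open>V\<^sup>k \<Rightarrow> \<complex>\<close>.
\<close>

definition alternating :: "('v::real_vector list \<Rightarrow> complex) \<Rightarrow> bool" where
  "alternating a \<longleftrightarrow> (\<forall>us ws. linear (\<lambda>v. a (us @ v # ws))) \<and> (\<forall>vs. \<not> distinct vs \<longrightarrow> a vs = 0)"

definition omit :: "nat \<Rightarrow> 'v list \<Rightarrow> 'v list" where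
  "omit i vs = take i vs @ drop (Suc i) vs"

definition unit_form :: "'v list \<Rightarrow> complex" where
  "unit_form vs = (if vs = [] then 1 else 0)"

definition covector_form :: "('v \<Rightarrow> complex) \<Rightarrow> 'v list \<Rightarrow> complex" where
  "covector_form \<xi> vs = (if length vs = 1 then \<xi> (hd vs) else 0)"

definition wedge1 :: "('v \<Rightarrow> complex) \<Rightarrow> ('v list \<Rightarrow> complex) \<Rightarrow> 'v list \<Rightarrow> complex" where
  "wedge1 \<xi> a vs = (\<Sum>i<length vs. (-1) ^ i * \<xi> (vs ! i) * a (omit i vs))"

definition cspan :: "('s \<Rightarrow> complex) set \<Rightarrow> ('s \<Rightarrow> complex) set" where
  "cspan S = {\<lambda>s. \<Sum>i<n. c i * b i s | (n::nat) c b. \<forall>i<n. b i \<in> S}"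

section \<open>Differential forms and de Rham cohomology of \<open>V/D\<close>\<close>

type_synonym 'v form = "'v \<Rightarrow> 'v list \<Rightarrow> complex"

definition pullback :: "('v::euclidean_space \<Rightarrow> 'v) \<Rightarrow> 'v form \<Rightarrow> 'v form" where
  "pullback f \<omega> = (\<lambda>x vs. \<omega> (f x) (map (frechet_derivative f (at x)) vs))"

definition invariant_form :: "('v::euclidean_space \<Rightarrow> 'v) set \<Rightarrow> 'v form \<Rightarrow> bool" where
  "invariant_form D \<omega> \<longleftrightarrow> (\<forall>f\<in>D. pullback f \<omega> = \<omega>)"

definition ext_d :: "'v::euclidean_space form \<Rightarrow> 'v form" where
  "ext_d \<omega> = (\<lambda>x vs. \<Sum>i<length vs.
      (-1) ^ i * frechet_derivative (\<lambda>y. \<omega> y (omit i vs)) (at x) (vs ! i))"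

definition forms :: "('v::euclidean_space \<Rightarrow> 'v) set \<Rightarrow> 'v form set" where
  "forms D = {\<omega>. (\<forall>x. alternating (\<omega> x)) \<and> (\<forall>vs. smooth (\<lambda>x. \<omega> x vs)) \<and> invariant_form D \<omega>}"

definition k_forms :: "('v::euclidean_space \<Rightarrow> 'v) set \<Rightarrow> nat \<Rightarrow> 'v form set" where
  "k_forms D k = {\<omega> \<in> forms D. \<forall>x vs. length vs \<noteq> k \<longrightarrow> \<omega> x vs = 0}"

definition closed_forms :: "('v::euclidean_space \<Rightarrow> 'v) set \<Rightarrow> 'v form set" where
  "closed_forms D = {\<omega> \<in> forms D. ext_d \<omega> = (\<lambda>x vs. 0)}"

definition exact_forms :: "('v::euclidean_space \<Rightarrow> 'v) set \<Rightarrow> 'v form set" where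
  "exact_forms D = ext_d ` forms D"

definition closed_k_forms :: "('v::euclidean_space \<Rightarrow> 'v) set \<Rightarrow> nat \<Rightarrow> 'v form set" where
  "closed_k_forms D k = {\<omega> \<in> k_forms D k. ext_d \<omega> = (\<lambda>x vs. 0)}"

definition exact_k_forms :: "('v::euclidean_space \<Rightarrow> 'v) set \<Rightarrow> nat \<Rightarrow> 'v form set" where
  "exact_k_forms D k = (case k of 0 \<Rightarrow> {\<lambda>x vs. 0} | Suc j \<Rightarrow> ext_d ` k_forms D j)"

text \<open>
  Cohomology classes are cosets modulo the space \<open>B\<close> of exact forms.
  The vector space operations on cosets are the ones induced by representatives.
\<close>

definition coh_class :: "'v form set \<Rightarrow> 'v form \<Rightarrow> 'v form set" where
  "coh_class B \<alpha> = {\<beta>. (\<lambda>x vs. \<beta> x vs - \<alpha> x vs) \<in> B}"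

definition H_dR :: "('v::euclidean_space \<Rightarrow> 'v) set \<Rightarrow> nat \<Rightarrow> 'v form set set" where
  "H_dR D k = coh_class (exact_k_forms D k) ` closed_k_forms D k"

definition GH_dR :: "('v::euclidean_space \<Rightarrow> 'v) set \<Rightarrow> 'v form set set" where
  "GH_dR D = coh_class (exact_forms D) ` closed_forms D"

definition sum_of_subspaces ::
    "'v form set \<Rightarrow> 'i set \<Rightarrow> ('i \<Rightarrow> 'v form set set) \<Rightarrow> 'v form set set" where
  "sum_of_subspaces B I W =
     {coh_class B (\<lambda>x vs. \<Sum>i\<in>F. \<alpha> i x vs) | F \<alpha>.
        finite F \<and> F \<subseteq> I \<and> (\<forall>i\<in>F. coh_class B (\<alpha> i) \<in> W i)}"

definition sum_is_direct ::
    "'v form set \<Rightarrow> 'i set \<Rightarrow> ('i \<Rightarrow> 'v form set set) \<Rightarrow> bool" where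
  "sum_is_direct B I W \<longleftrightarrow>
     (\<forall>F \<alpha>. finite F \<and> F \<subseteq> I \<and> (\<forall>i\<in>F. coh_class B (\<alpha> i) \<in> W i) \<and>
        coh_class B (\<lambda>x vs. \<Sum>i\<in>F. \<alpha> i x vs) = coh_class B (\<lambda>x vs. 0)
      \<longrightarrow> (\<forall>i\<in>F. coh_class B (\<alpha> i) = coh_class B (\<lambda>x vs. 0)))"

section \<open>Almost-complex structures\<close>

definition equivariant :: "('v::euclidean_space \<Rightarrow> 'v) set \<Rightarrow> ('v \<Rightarrow> 'v \<Rightarrow>\<^sub>L 'v) \<Rightarrow> bool" where
  "equivariant D J \<longleftrightarrow> (\<forall>f\<in>D. \<forall>x v.
     blinfun_apply (J (f x)) (frechet_derivative f (at x) v)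
       = frechet_derivative f (at x) (blinfun_apply (J x) v))"

definition almost_complex ::
    "('v::euclidean_space \<Rightarrow> 'v) set \<Rightarrow> ('v \<Rightarrow> 'v \<Rightarrow>\<^sub>L 'v) \<Rightarrow> bool" where
  "almost_complex D J \<longleftrightarrow> smooth J \<and> equivariant D J \<and> (\<forall>x. J x o\<^sub>L J x = - id_blinfun)"

definition covectors_10 :: "('v::euclidean_space \<Rightarrow>\<^sub>L 'v) \<Rightarrow> ('v \<Rightarrow> complex) set" where
  "covectors_10 j = {\<xi>. linear \<xi> \<and> (\<forall>v. \<xi> (blinfun_apply j v) = \<i> * \<xi> v)}"

definition covectors_01 :: "('v::euclidean_space \<Rightarrow>\<^sub>L 'v) \<Rightarrow> ('v \<Rightarrow> complex) set" where
  "covectors_01 j = {\<xi>. linear \<xi> \<and> (\<forall>v. \<xi> (blinfun_apply j v) = - \<i> * \<xi> v)}"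

definition Lambda_pq ::
    "('v::euclidean_space \<Rightarrow>\<^sub>L 'v) \<Rightarrow> nat \<Rightarrow> nat \<Rightarrow> ('v list \<Rightarrow> complex) set" where
  "Lambda_pq j p q = cspan {foldr wedge1 (as @ bs) unit_form | as bs.
     length as = p \<and> set as \<subseteq> covectors_10 j \<and> length bs = q \<and> set bs \<subseteq> covectors_01 j}"

definition H_pq :: "('v::euclidean_space \<Rightarrow> 'v) set \<Rightarrow> ('v \<Rightarrow> 'v \<Rightarrow>\<^sub>L 'v) \<Rightarrow> nat \<Rightarrow> nat
    \<Rightarrow> 'v form set set" where
  "H_pq D J p q = {coh_class (exact_k_forms D (p + q)) \<alpha> | \<alpha>.
     \<alpha> \<in> closed_k_forms D (p + q) \<and> (\<forall>x. \<alpha> x \<in> Lambda_pq (J x) p q)}"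

definition complex_C_infinity_full ::
    "('v::euclidean_space \<Rightarrow> 'v) set \<Rightarrow> ('v \<Rightarrow> 'v \<Rightarrow>\<^sub>L 'v) \<Rightarrow> nat \<Rightarrow> bool" where
  "complex_C_infinity_full D J k \<longleftrightarrow>
     sum_of_subspaces (exact_k_forms D k) {(p, q). p + q = k} (\<lambda>(p, q). H_pq D J p q) = H_dR D k"

section \<open>Generalized-almost-complex structures\<close>

type_synonym 'v gtangent = "'v \<times> ('v \<Rightarrow>\<^sub>L real)"

definition gpairing :: "'v::euclidean_space gtangent \<Rightarrow> 'v gtangent \<Rightarrow> real" where
  "gpairing E F = (blinfun_apply (snd E) (fst F) + blinfun_apply (snd F) (fst E)) / 2"

text \<open>
  The last clause says that \<open>\<J>\<close> commutes with the action
  \<open>(X, \<xi>) \<mapsto> (df X, \<xi> \<circ> df\<^sup>-\<^sup>1)\<close> of \<open>D\<close>, hence descends to \<open>V/D\<close>.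
\<close>

definition generalized_almost_complex ::
    "('v::euclidean_space \<Rightarrow> 'v) set \<Rightarrow> ('v \<Rightarrow> 'v gtangent \<Rightarrow> 'v gtangent) \<Rightarrow> bool" where
  "generalized_almost_complex D \<J> \<longleftrightarrow>
     (\<forall>x. linear (\<J> x)) \<and>
     (\<forall>E. smooth (\<lambda>x. \<J> x E)) \<and>
     (\<forall>x E F. gpairing (\<J> x E) (\<J> x F) = gpairing E F) \<and>
     (\<forall>x E. \<J> x (\<J> x E) = - E) \<and>
     (\<forall>f\<in>D. \<forall>x X \<xi> \<eta>.
        (\<forall>v. blinfun_apply \<eta> v = blinfun_apply \<xi> (frechet_derivative f (at x) v)) \<longrightarrow>
        fst (\<J> (f x) (frechet_derivative f (at x) X, \<xi>))
          = frechet_derivative f (at x) (fst (\<J> x (X, \<eta>))) \<and>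
        (\<forall>v. blinfun_apply (snd (\<J> (f x) (frechet_derivative f (at x) X, \<xi>)))
                (frechet_derivative f (at x) v)
             = blinfun_apply (snd (\<J> x (X, \<eta>))) v))"

definition gen_of_complex ::
    "('v::euclidean_space \<Rightarrow> 'v \<Rightarrow>\<^sub>L 'v) \<Rightarrow> 'v \<Rightarrow> 'v gtangent \<Rightarrow> 'v gtangent" where
  "gen_of_complex J x = (\<lambda>(X, \<xi>). (- blinfun_apply (J x) X, \<xi> o\<^sub>L J x))"

lemma C_k_bounded_linear:
  assumes L: "bounded_linear L"
  shows "C_k n f \<Longrightarrow> C_k n (\<lambda>x. L (f x))"
proof (induction n arbitrary: f)
  case 0
  then show ?case using bounded_linear.continuous_on[OF L] by auto
next
  case (Suc n)
  have D: "((\<lambda>x. L (f x)) has_derivative (\<lambda>v. L (frechet_derivative f (at x) v))) (at x)" for x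
    using Suc.prems by (intro bounded_linear.has_derivative[OF L]) (auto simp: frechet_derivative_works[symmetric])
  have E: "frechet_derivative (\<lambda>x. L (f x)) (at x) v = L (frechet_derivative f (at x) v)" for x v
    using frechet_derivative_at[OF D[of x]] by metis
  show ?case using D Suc by (auto simp: E differentiable_def)
qed

lemma generalized_almost_complex_gen_of_complex:
  fixes J :: "'a::euclidean_space \<Rightarrow> 'a \<Rightarrow>\<^sub>L 'a"
  assumes "almost_complex D J"
  shows "generalized_almost_complex D (gen_of_complex J)"
proof -
  have sq: "blinfun_apply (J x) (blinfun_apply (J x) v) = - v" for x v
    using assms unfolding almost_complex_def
    by (metis blinfun_apply_blinfun_compose id_blinfun.rep_eq uminus_blinfun.rep_eq)
  have sq': "J x o\<^sub>L J x = - id_blinfun" for x using assms unfolding almost_complex_def by auto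
  have sm: "C_k n J" for n using assms unfolding almost_complex_def smooth_def by auto
  have bl: "bounded_linear (\<lambda>j. (- blinfun_apply j (fst E), snd E o\<^sub>L j))" for E :: "'a gtangent"
    by (intro bounded_linear_Pair bounded_linear_minus
        bounded_bilinear.bounded_linear_right[OF bounded_bilinear_blinfun_compose]
        bounded_bilinear.bounded_linear_left[OF bounded_bilinear_blinfun_apply] bounded_linear_ident)
  have eq: "blinfun_apply (J (f x)) (frechet_derivative f (at x) v)
       = frechet_derivative f (at x) (blinfun_apply (J x) v)" if "f \<in> D" for f x v
    using assms that unfolding almost_complex_def equivariant_def by auto
  show ?thesis unfolding generalized_almost_complex_def
  proof (intro conjI allI ballI impI)
    fix x show "linear (gen_of_complex J x)"
      by (rule linearI) (auto simp: gen_of_complex_def blinfun.bilinear_simps bounded_bilinear.add_left[OF bounded_bilinear_blinfun_compose] bounded_bilinear.scaleR_left[OF bounded_bilinear_blinfun_compose])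
  next
    fix E show "smooth (\<lambda>x. gen_of_complex J x E)"
      using C_k_bounded_linear[OF bl[of E] sm] by (simp add: smooth_def gen_of_complex_def case_prod_beta)
  next
    fix x E F show "gpairing (gen_of_complex J x E) (gen_of_complex J x F) = gpairing E F"
      by (simp add: gpairing_def gen_of_complex_def case_prod_beta blinfun.bilinear_simps sq)
  next
    fix x E show "gen_of_complex J x (gen_of_complex J x E) = - E"
      apply (cases E)
      apply (simp add: gen_of_complex_def blinfun.bilinear_simps sq )
      by (rule blinfun_eqI) (simp add: blinfun.bilinear_simps sq)
  next
    fix f x X and \<xi> \<eta> :: "'a \<Rightarrow>\<^sub>L real" assume "f \<in> D" and "\<forall>v. blinfun_apply \<eta> v = blinfun_apply \<xi> (frechet_derivative f (at x) v)"
    then show "\<And>v. blinfun_apply (snd (gen_of_complex J (f x) (frechet_derivative f (at x) X, \<xi>)))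
                (frechet_derivative f (at x) v)
             = blinfun_apply (snd (gen_of_complex J x (X, \<eta>))) v"
      by (simp add: gen_of_complex_def eq)
  next
    fix f x X and \<xi> \<eta> :: "'a \<Rightarrow>\<^sub>L real" assume f: "f \<in> D" and "\<forall>v. blinfun_apply \<eta> v = blinfun_apply \<xi> (frechet_derivative f (at x) v)"
    have neg: "frechet_derivative f (at x) (- Y) = - frechet_derivative f (at x) Y" for Y
      using eq[OF f, of x "blinfun_apply (J x) Y"] by (simp add: eq[OF f, symmetric] sq)
    then show "fst (gen_of_complex J (f x) (frechet_derivative f (at x) X, \<xi>))
          = frechet_derivative f (at x) (fst (gen_of_complex J x (X, \<eta>)))"
      by (simp add: gen_of_complex_def eq f neg)
  qed
qed

text \<open>
  A pair \<open>(E, F)\<close> of elements of \<open>T \<oplus> T\<^sup>*\<close> stands for the element \<open>E + \<i> F\<close> of \<open>(T \<oplus> T\<^sup>*) \<otimes> \<complex>\<close>.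
\<close>

definition L_space :: "('v::euclidean_space gtangent \<Rightarrow> 'v gtangent)
    \<Rightarrow> ('v gtangent \<times> 'v gtangent) set" where
  "L_space \<A> = {(E, F). \<A> E = - F \<and> \<A> F = E}"

definition L_bar :: "('v::euclidean_space gtangent \<Rightarrow> 'v gtangent)
    \<Rightarrow> ('v gtangent \<times> 'v gtangent) set" where
  "L_bar \<A> = {(E, - F) | E F. (E, F) \<in> L_space \<A>}"

definition clifford :: "'v::euclidean_space gtangent \<Rightarrow> ('v list \<Rightarrow> complex) \<Rightarrow> 'v list \<Rightarrow> complex" where
  "clifford E \<phi> vs = \<phi> (fst E # vs) + wedge1 (\<lambda>v. of_real (blinfun_apply (snd E) v)) \<phi> vs"

definition clifford_c :: "'v::euclidean_space gtangent \<times> 'v gtangent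
    \<Rightarrow> ('v list \<Rightarrow> complex) \<Rightarrow> 'v list \<Rightarrow> complex" where
  "clifford_c l \<phi> vs = clifford (fst l) \<phi> vs + \<i> * clifford (snd l) \<phi> vs"

definition U_line :: "('v::euclidean_space gtangent \<Rightarrow> 'v gtangent) \<Rightarrow> ('v list \<Rightarrow> complex) set" where
  "U_line \<A> = {\<phi>. alternating \<phi> \<and>
     (\<phi> = (\<lambda>vs. 0) \<or> {l. clifford_c l \<phi> = (\<lambda>vs. 0)} = L_space \<A>)}"

text \<open>
  \<open>U\<^sup>k = \<Lambda>\<^sup>n\<^sup>-\<^sup>k L\<^sup>- \<cdot> U\<close>. As \<open>L\<^sup>-\<close> is isotropic, its elements anticommute in the Clifford algebra,
  so \<open>l\<^sub>1 \<and> \<dots> \<and> l\<^sub>m\<close> acts as the iterated Clifford product \<open>l\<^sub>1 \<cdot> \<dots> \<cdot> l\<^sub>m\<close>.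
\<close>

definition U_space :: "('v::euclidean_space gtangent \<Rightarrow> 'v gtangent) \<Rightarrow> int
    \<Rightarrow> ('v list \<Rightarrow> complex) set" where
  "U_space \<A> k = cspan {foldr clifford_c ls \<phi> | ls \<phi>.
     int (length ls) = int (DIM('v) div 2) - k \<and> set ls \<subseteq> L_bar \<A> \<and> \<phi> \<in> U_line \<A>}"

definition GH_k :: "('v::euclidean_space \<Rightarrow> 'v) set \<Rightarrow> ('v \<Rightarrow> 'v gtangent \<Rightarrow> 'v gtangent) \<Rightarrow> int
    \<Rightarrow> 'v form set set" where
  "GH_k D \<J> k = {coh_class (exact_forms D) \<alpha> | \<alpha>.
     \<alpha> \<in> closed_forms D \<and> (\<forall>x. \<alpha> x \<in> U_space (\<J> x) k)}"

definition gen_C_infinity_pure_and_full ::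
    "('v::euclidean_space \<Rightarrow> 'v) set \<Rightarrow> ('v \<Rightarrow> 'v gtangent \<Rightarrow> 'v gtangent) \<Rightarrow> bool" where
  "gen_C_infinity_pure_and_full D \<J> \<longleftrightarrow>
     sum_is_direct (exact_forms D) UNIV (GH_k D \<J>) \<and>
     sum_of_subspaces (exact_forms D) UNIV (GH_k D \<J>) = GH_dR D"

section \<open>The nilmanifold underlying the Iwasawa manifold\<close>

text \<open>The Heisenberg group is identified with \<open>\<complex>\<^sup>3\<close> through the entries above the diagonal.\<close>

definition heis_mat :: "complex ^ 3 \<Rightarrow> complex ^ 3 ^ 3" where
  "heis_mat z = vector [vector [1, z $ 1, z $ 3], vector [0, 1, z $ 2], vector [0, 0, 1]]"

definition heis_chart :: "complex ^ 3 ^ 3 \<Rightarrow> complex ^ 3" where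
  "heis_chart A = vector [A $ 1 $ 2, A $ 2 $ 3, A $ 1 $ 3]"

definition heis_mult :: "complex ^ 3 \<Rightarrow> complex ^ 3 \<Rightarrow> complex ^ 3" where
  "heis_mult g h = heis_chart (heis_mat g ** heis_mat h)"

definition gaussian_mat :: "complex ^ 3 ^ 3 \<Rightarrow> bool" where
  "gaussian_mat A \<longleftrightarrow> (\<forall>i j. Re (A $ i $ j) \<in> \<int> \<and> Im (A $ i $ j) \<in> \<int>)"

definition GL3_gauss :: "(complex ^ 3 ^ 3) set" where
  "GL3_gauss = {A. gaussian_mat A \<and> (\<exists>B. gaussian_mat B \<and> A ** B = mat 1 \<and> B ** A = mat 1)}"

definition heis_lattice :: "(complex ^ 3) set" where
  "heis_lattice = {g. heis_mat g \<in> GL3_gauss}"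

definition iwasawa_deck :: "(complex ^ 3 \<Rightarrow> complex ^ 3) set" where
  "iwasawa_deck = heis_mult ` heis_lattice"

definition left_translations :: "(complex ^ 3 \<Rightarrow> complex ^ 3) set" where
  "left_translations = range heis_mult"

definition real_1_form :: "('v::euclidean_space \<Rightarrow> 'v \<Rightarrow>\<^sub>L real) \<Rightarrow> 'v form" where
  "real_1_form e x = covector_form (\<lambda>v. of_real (blinfun_apply (e x) v))"

definition wedge_real_1_forms ::
    "('v::euclidean_space \<Rightarrow> 'v \<Rightarrow>\<^sub>L real) \<Rightarrow> ('v \<Rightarrow> 'v \<Rightarrow>\<^sub>L real) \<Rightarrow> 'v form" where
  "wedge_real_1_forms e f x = wedge1 (\<lambda>v. of_real (blinfun_apply (e x) v)) (real_1_form f x)"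

definition left_invariant_coframe ::
    "(nat \<Rightarrow> complex ^ 3 \<Rightarrow> (complex ^ 3) \<Rightarrow>\<^sub>L real) \<Rightarrow> bool" where
  "left_invariant_coframe e \<longleftrightarrow>
     (\<forall>k\<in>{1..6}. smooth (e k) \<and> invariant_form left_translations (real_1_form (e k))) \<and>
     (\<forall>x. inj_on (\<lambda>k. e k x) {1..6} \<and> independent ((\<lambda>k. e k x) ` {1..6}) \<and>
          span ((\<lambda>k. e k x) ` {1..6}) = UNIV)"

definition iwasawa_structure_equations ::
    "(nat \<Rightarrow> complex ^ 3 \<Rightarrow> (complex ^ 3) \<Rightarrow>\<^sub>L real) \<Rightarrow> bool" where
  "iwasawa_structure_equations e \<longleftrightarrow>
     (\<forall>k\<in>{1..4}. ext_d (real_1_form (e k)) = (\<lambda>x vs. 0)) \<and>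
     ext_d (real_1_form (e 5)) = (\<lambda>x vs.
        wedge_real_1_forms (e 1) (e 3) x vs - wedge_real_1_forms (e 2) (e 4) x vs) \<and>
     ext_d (real_1_form (e 6)) = (\<lambda>x vs.
        wedge_real_1_forms (e 1) (e 4) x vs + wedge_real_1_forms (e 2) (e 3) x vs)"

definition phi1 :: "(nat \<Rightarrow> 'v::euclidean_space \<Rightarrow> 'v \<Rightarrow>\<^sub>L real) \<Rightarrow> real \<Rightarrow> 'v \<Rightarrow> 'v \<Rightarrow> complex" where
  "phi1 e t x v = of_real (blinfun_apply (e 1 x) v) + \<i> * of_real (blinfun_apply (e 2 x) v)"

definition phi2 :: "(nat \<Rightarrow> 'v::euclidean_space \<Rightarrow> 'v \<Rightarrow>\<^sub>L real) \<Rightarrow> real \<Rightarrow> 'v \<Rightarrow> 'v \<Rightarrow> complex" where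
  "phi2 e t x v = of_real (blinfun_apply (e 3 x) v) + \<i> *
     of_real (cos (pi * t) * blinfun_apply (e 4 x) v + sin (pi * t) * blinfun_apply (e 6 x) v)"

definition phi3 :: "(nat \<Rightarrow> 'v::euclidean_space \<Rightarrow> 'v \<Rightarrow>\<^sub>L real) \<Rightarrow> real \<Rightarrow> 'v \<Rightarrow> 'v \<Rightarrow> complex" where
  "phi3 e t x v = of_real (blinfun_apply (e 5 x) v) - \<i> *
     of_real (sin (pi * t) * blinfun_apply (e 4 x) v - cos (pi * t) * blinfun_apply (e 6 x) v)"

end

theory Submission
  imports Defs "HOL-Complex_Analysis.Cauchy_Integral_Formula"
begin

text \<open>
  The class of \<open>e\<^sup>3\<close> is not a sum of classes with closed representatives of pure type, and this is a
  statement about forms of degree one in both settings: the exterior derivative respects the degree, and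
  the degree-one part of an element of \<open>U\<^sup>k\<close> is of type \<open>(1, 0)\<close>, of type \<open>(0, 1)\<close> or zero
  (\<open>U_space_degree_1_pure\<close>). So suppose \<open>e\<^sup>3 = \<Sum> \<alpha>\<^sub>i + dg\<close> in degree one, with every \<open>\<alpha>\<^sub>i\<close> closed and of
  pure type, on the quotient of the Heisenberg group.

  The structure \<open>J\<^sub>t\<close> sends the left-invariant field \<open>P = sin (\<pi> t) e\<^sub>3 + cos (\<pi> t) e\<^sub>5\<close> to the central
  field \<open>Q = e\<^sub>6\<close> (\<open>central_direction\<close>). A closed form \<open>\<alpha>\<close> on the simply connected group has a primitive
  \<open>F\<close>. If \<open>\<alpha>\<close> has type \<open>(1, 0)\<close>, then \<open>\<alpha> Q = \<i> \<alpha> P\<close>, which says that \<open>F\<close> is holomorphic along the orbits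
  \<open>s + \<i> r \<mapsto> z exp (s P + r Q)\<close> of the commuting fields \<open>P\<close> and \<open>Q\<close>. Its derivative \<open>\<alpha> P\<close> descends to the
  compact quotient and is bounded, so it is constant by Liouville's theorem. On the other hand central
  elements are quadratically distorted: the central translation at distance \<open>s\<^sup>2\<close> is a commutator of
  elements at distance \<open>O(s)\<close>, so \<open>F\<close> grows sublinearly in the direction \<open>Q\<close>
  (\<open>growth_along_center\<close>). Hence \<open>\<alpha> P = 0\<close> (\<open>holomorphic_along_plane_zero\<close>), and similarly for type
  \<open>(0, 1)\<close>.

  Evaluating the decomposition of \<open>e\<^sup>3\<close> on \<open>P\<close> now gives \<open>P g = sin (\<pi> t)\<close>, a nonzero constant for
  \<open>0 < t < 1\<close>, although \<open>g\<close> is bounded (\<open>e3_not_sum_of_pure\<close>).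
\<close>

section \<open>Calculus in the coordinates of the Heisenberg group\<close>

lemma linear_expand:
  fixes l :: "'v::euclidean_space \<Rightarrow> 'b::real_vector"
  assumes "linear l"
  shows "l w = (\<Sum>b\<in>Basis. (w \<bullet> b) *\<^sub>R l b)"
  using linear_sum[OF assms, of "\<lambda>b. (w \<bullet> b) *\<^sub>R b" Basis]
  by (simp add: euclidean_representation linear_cmul[OF assms])

lemma bounded_linear_vector3:
  "bounded_linear (\<lambda>(a, b, c). vector [a, b, c] :: complex ^ 3)"
  by (intro linear_conv_bounded_linear[THEN iffD1] linearI)
     (auto simp: vec_eq_iff forall_3)

lemma has_derivative_vector3 [derivative_intros]:
  fixes f g h :: "'a::real_normed_vector \<Rightarrow> complex"
  assumes "(f has_derivative f') (at x within S)" "(g has_derivative g') (at x within S)"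
    "(h has_derivative h') (at x within S)"
  shows "((\<lambda>x. vector [f x, g x, h x] :: complex ^ 3) has_derivative
          (\<lambda>v. vector [f' v, g' v, h' v])) (at x within S)"
  using bounded_linear.has_derivative[OF bounded_linear_vector3
      has_derivative_Pair[OF assms(1) has_derivative_Pair[OF assms(2,3)]]]
  by simp

lemma continuous_on_vector3 [continuous_intros]:
  fixes f g h :: "'a::topological_space \<Rightarrow> complex"
  assumes "continuous_on S f" "continuous_on S g" "continuous_on S h"
  shows "continuous_on S (\<lambda>x. vector [f x, g x, h x] :: complex ^ 3)"
  using bounded_linear.continuous_on[OF bounded_linear_vector3
      continuous_on_Pair[OF assms(1) continuous_on_Pair[OF assms(2,3)]]]
  by simp

lemma has_derivative_nth3 [derivative_intros]:
  "((\<lambda>x::complex ^ 3. x $ i) has_derivative (\<lambda>v. v $ i)) F"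
  by (rule bounded_linear.has_derivative[OF bounded_linear_vec_nth has_derivative_ident])

lemma heis_mult_eq:
  "heis_mult g h = vector [g $ 1 + h $ 1, g $ 2 + h $ 2, g $ 3 + h $ 3 + g $ 1 * h $ 2]"
  by (simp add: heis_mult_def heis_chart_def heis_mat_def matrix_matrix_mult_def sum_3 vec_eq_iff
      forall_3)

text \<open>
  The left-invariant vector field with value \<open>v\<close> at the neutral element: \<open>lfield v z\<close> is the image
  of \<open>v\<close> under the differential of the left translation by \<open>z\<close>, which is the same at all points.
\<close>

definition lfield :: "complex ^ 3 \<Rightarrow> complex ^ 3 \<Rightarrow> complex ^ 3" where
  "lfield v z = vector [v $ 1, v $ 2, v $ 3 + z $ 1 * v $ 2]"

lemma has_derivative_heis_mult:
  "(heis_mult g has_derivative (\<lambda>v. lfield v g)) (at x)"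
  unfolding heis_mult_eq lfield_def
  by (auto intro!: derivative_eq_intros)

lemma frechet_derivative_heis_mult:
  "frechet_derivative (heis_mult g) (at x) = (\<lambda>v. lfield v g)"
  using frechet_derivative_at[OF has_derivative_heis_mult[of g x]] by simp

lemma lfield_lfield: "lfield (lfield v z) g = lfield v (heis_mult g z)"
  by (simp add: lfield_def heis_mult_eq vec_eq_iff forall_3 algebra_simps)

lemma lfield_0 [simp]: "lfield v 0 = v"
  by (simp add: lfield_def vec_eq_iff forall_3)

lemma heis_mult_0 [simp]: "heis_mult g 0 = g"
  by (simp add: heis_mult_eq vec_eq_iff forall_3)

lemma lfield_center [simp]: "lfield (vector [0, 0, c]) z = vector [0, 0, c]"
  by (simp add: lfield_def)

text \<open>
  The one-parameter subgroup \<open>s \<mapsto> exp (s v)\<close>; the quadratic term is that of the matrix exponential.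
\<close>

definition heis_exp :: "complex ^ 3 \<Rightarrow> real \<Rightarrow> complex ^ 3" where
  "heis_exp v s = vector [of_real s * v $ 1, of_real s * v $ 2,
     of_real s * v $ 3 + (of_real s)\<^sup>2 / 2 * v $ 1 * v $ 2]"

lemma has_derivative_heis_exp:
  "((\<lambda>s. heis_mult z (heis_exp v s)) has_derivative
     (\<lambda>h. h *\<^sub>R lfield v (heis_mult z (heis_exp v s)))) (at s)"
  unfolding heis_mult_eq heis_exp_def
  by (auto intro!: derivative_eq_intros ext
      simp: lfield_def vec_eq_iff forall_3 power2_eq_square algebra_simps
        scaleR_conv_of_real[where 'a = complex])

section \<open>Forms on the compact quotient are bounded in left-invariant frames\<close>

lemma heis_mat_mult: "heis_mat g ** heis_mat h = heis_mat (heis_mult g h)"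
  by (simp add: heis_mult_eq heis_mat_def matrix_matrix_mult_def sum_3 vec_eq_iff forall_3)

lemma heis_mat_0: "heis_mat 0 = mat 1"
  by (simp add: heis_mat_def mat_def vec_eq_iff forall_3)

lemma gaussian_in_heis_lattice:
  assumes "\<forall>i. Re (g $ i) \<in> \<int> \<and> Im (g $ i) \<in> \<int>"
  shows "g \<in> heis_lattice"
proof -
  \<comment> \<open>the group inverse of \<open>g\<close>\<close>
  define h :: "complex ^ 3" where "h = vector [- g $ 1, - g $ 2, - g $ 3 + g $ 1 * g $ 2]"
  have "heis_mult g h = 0" "heis_mult h g = 0"
    by (simp_all add: heis_mult_eq h_def vec_eq_iff forall_3)
  then have "heis_mat g ** heis_mat h = mat 1" "heis_mat h ** heis_mat g = mat 1"
    by (simp_all add: heis_mat_mult heis_mat_0)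
  moreover have "gaussian_mat (heis_mat g)" "gaussian_mat (heis_mat h)"
    using assms by (auto simp: gaussian_mat_def heis_mat_def h_def forall_3)
  ultimately show ?thesis
    unfolding heis_lattice_def GL3_gauss_def by blast
qed

lemma gaussian_floor:
  obtains a where "Re a \<in> \<int>" "Im a \<in> \<int>" "norm (a + z) \<le> 2"
proof
  define a where "a = Complex (- of_int \<lfloor>Re z\<rfloor>) (- of_int \<lfloor>Im z\<rfloor>)"
  show "Re a \<in> \<int>" "Im a \<in> \<int>" by (auto simp: a_def)
  have "\<bar>Re (a + z)\<bar> \<le> 1" "\<bar>Im (a + z)\<bar> \<le> 1" by (auto simp: a_def; linarith)+
  then show "norm (a + z) \<le> 2" using cmod_le[of "a + z"] by linarith
qed

text \<open>
  Compactness of the quotient: the lattice moves every point into a fixed ball, because it may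
  first correct the two coordinates of the base torus and then the central one.
\<close>

lemma bounded_invariant_function:
  fixes f :: "complex ^ 3 \<Rightarrow> complex"
  assumes cont: "continuous_on UNIV f"
    and inv: "\<And>g z. g \<in> heis_lattice \<Longrightarrow> f (heis_mult g z) = f z"
  shows "bounded (range f)"
proof -
  have "compact (f ` cball 0 6)"
    by (intro compact_continuous_image continuous_on_subset[OF cont]) auto
  then have "bounded (f ` cball 0 6)" by (rule compact_imp_bounded)
  moreover have "range f \<subseteq> f ` cball 0 6"
  proof
    fix w assume "w \<in> range f"
    then obtain z where w: "w = f z" by blast
    obtain a where a: "Re a \<in> \<int>" "Im a \<in> \<int>" "norm (a + z $ 1) \<le> 2" by (rule gaussian_floor)
    obtain b where b: "Re b \<in> \<int>" "Im b \<in> \<int>" "norm (b + z $ 2) \<le> 2" by (rule gaussian_floor)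
    obtain c where c: "Re c \<in> \<int>" "Im c \<in> \<int>" "norm (c + (z $ 3 + a * z $ 2)) \<le> 2"
      by (rule gaussian_floor)
    define g :: "complex ^ 3" where "g = vector [a, b, c]"
    have g: "g \<in> heis_lattice"
      by (rule gaussian_in_heis_lattice) (use a b c in \<open>auto simp: g_def forall_3\<close>)
    have "norm (heis_mult g z) \<le> (\<Sum>i\<in>UNIV. norm (heis_mult g z $ i))"
      by (simp add: norm_vec_def L2_set_le_sum)
    also have "\<dots> \<le> 6" using a b c by (simp add: sum_3 heis_mult_eq g_def algebra_simps)
    finally have "heis_mult g z \<in> cball 0 6" by simp
    then show "w \<in> f ` cball 0 6" using inv[OF g, of z] w by (metis imageI)
  qed
  ultimately show ?thesis by (rule bounded_subset)
qed

lemma smooth_differentiable: "smooth f \<Longrightarrow> f differentiable (at x)"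
  unfolding smooth_def by (metis C_k.simps(2))

lemma smooth_partial_continuous:
  "smooth f \<Longrightarrow> continuous_on UNIV (\<lambda>x. frechet_derivative f (at x) v)"
  unfolding smooth_def by (metis C_k.simps)

lemma smooth_continuous: "smooth f \<Longrightarrow> continuous_on UNIV f"
  unfolding smooth_def by (metis C_k.simps(1))

lemma forms_linear_degree_1:
  assumes "\<omega> \<in> forms D"
  shows "linear (\<lambda>v. \<omega> x [v])"
proof -
  have "linear (\<lambda>v. \<omega> x ([] @ v # []))"
    using assms unfolding forms_def alternating_def by blast
  then show ?thesis by simp
qed

lemma invariant_form_lfield:
  assumes "invariant_form D \<omega>" "heis_mult g \<in> D"
  shows "\<omega> (heis_mult g z) (map (\<lambda>v. lfield v g) vs) = \<omega> z vs"
proof -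
  have "pullback (heis_mult g) \<omega> z vs = \<omega> z vs"
    using assms unfolding invariant_form_def by metis
  then show ?thesis by (simp add: pullback_def frechet_derivative_heis_mult)
qed

lemma bounded_function_part:
  assumes "\<omega> \<in> forms iwasawa_deck"
  shows "bounded (range (\<lambda>z. \<omega> z []))"
proof (rule bounded_invariant_function)
  show "continuous_on UNIV (\<lambda>z. \<omega> z [])"
    using assms by (auto simp: forms_def intro!: smooth_continuous)
  fix g z assume "g \<in> heis_lattice"
  then have "heis_mult g \<in> iwasawa_deck" by (auto simp: iwasawa_deck_def)
  then show "\<omega> (heis_mult g z) [] = \<omega> z []"
    using invariant_form_lfield[of iwasawa_deck \<omega> g z "[]"] assms by (simp add: forms_def)
qed

text \<open>
  The coefficients of an invariant form descend to the quotient only in a left-invariant frame: the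
  coordinate fields are not invariant under the lattice.
\<close>

lemma bounded_on_lfield:
  assumes "\<omega> \<in> forms iwasawa_deck"
  shows "bounded (range (\<lambda>z. \<omega> z [lfield v z]))"
proof (rule bounded_invariant_function)
  have lin: "linear (\<lambda>v. \<omega> z [v])" for z by (rule forms_linear_degree_1[OF assms])
  have "\<omega> z [lfield v z] = (\<Sum>b\<in>Basis. (lfield v z \<bullet> b) *\<^sub>R \<omega> z [b])" for z
    by (rule linear_expand[OF lin])
  moreover have "continuous_on UNIV (\<lambda>z. \<omega> z [b])" for b
    using assms by (auto simp: forms_def intro!: smooth_continuous)
  moreover have "continuous_on UNIV (lfield v)"
    unfolding lfield_def by (intro continuous_intros)
  ultimately show "continuous_on UNIV (\<lambda>z. \<omega> z [lfield v z])"
    by (auto intro!: continuous_intros)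
  fix g z assume "g \<in> heis_lattice"
  then have "heis_mult g \<in> iwasawa_deck" by (auto simp: iwasawa_deck_def)
  then show "\<omega> (heis_mult g z) [lfield v (heis_mult g z)] = \<omega> z [lfield v z]"
    using invariant_form_lfield[of iwasawa_deck \<omega> g z "[lfield v z]"] assms
    by (simp add: forms_def lfield_lfield)
qed

section \<open>Primitives of closed 1-forms on a Euclidean space\<close>

text \<open>
  The primitive is \<open>F x = \<integral> a (s x) x ds\<close> over \<open>[0, 1]\<close>. Closedness turns the derivative of the
  integrand in the direction \<open>w\<close> into the derivative of \<open>s \<mapsto> s a (s x) w\<close>, whose integral is \<open>a x w\<close>.
\<close>

lemma closed_1_form_primitive:
  fixes a :: "'v::euclidean_space \<Rightarrow> 'v \<Rightarrow> complex"
  assumes lin: "\<And>x. linear (a x)"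
    and diff: "\<And>x v. (\<lambda>y. a y v) differentiable (at x)"
    and cont: "\<And>v w. continuous_on UNIV (\<lambda>x. frechet_derivative (\<lambda>y. a y v) (at x) w)"
    and closed: "\<And>x v w. frechet_derivative (\<lambda>y. a y v) (at x) w
                          = frechet_derivative (\<lambda>y. a y w) (at x) v"
  obtains F where "\<And>x. (F has_derivative a x) (at x)"
proof -
  define D where "D y v w = frechet_derivative (\<lambda>y. a y v) (at y) w" for y v w
  have D: "((\<lambda>y. a y v) has_derivative D y v) (at y)" for v y
    using diff[of v y] by (auto simp: D_def[abs_def] frechet_derivative_works)
  have Dlin: "linear (D y v)" for y v
    using has_derivative_linear[OF D] .
  have Dsym: "D y v w = D y w v" for y v w
    using closed by (simp add: D_def)
  have acont: "continuous_on S (\<lambda>y. a y v)" for v S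
    using D by (meson continuous_at_imp_continuous_on has_derivative_continuous)
  have Dcont: "continuous_on S (\<lambda>y. D y v w)" for v w S
    using cont[of v w] by (auto simp: D_def intro: continuous_on_subset)
  define G where "G x s w = a (s *\<^sub>R x) w + s *\<^sub>R D (s *\<^sub>R x) w x" for x and s :: real and w
  have Glin: "bounded_linear (G x s)" for x s
  proof -
    have "linear (\<lambda>w. D (s *\<^sub>R x) w x)" using Dlin[of "s *\<^sub>R x" x] by (simp add: Dsym[of _ _ x])
    then show ?thesis
      unfolding G_def linear_conv_bounded_linear[symmetric]
      by (intro linear_compose_add lin linear_compose_scale_right)
  qed
  have ray: "((\<lambda>s. s *\<^sub>R a (s *\<^sub>R x) w) has_vector_derivative G x s w) (at s within T)" for x w s T
  proof -
    have "((\<lambda>s. a (s *\<^sub>R x) w) has_derivative (\<lambda>h. D (s *\<^sub>R x) w (h *\<^sub>R x))) (at s)"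
      by (rule has_derivative_compose[OF _ D]) (auto intro!: derivative_eq_intros)
    then have "((\<lambda>s. a (s *\<^sub>R x) w) has_vector_derivative D (s *\<^sub>R x) w x) (at s)"
      by (simp add: has_vector_derivative_def linear_cmul[OF Dlin])
    then have "((\<lambda>s. s *\<^sub>R a (s *\<^sub>R x) w) has_vector_derivative G x s w) (at s)"
      unfolding G_def by (auto intro!: derivative_eq_intros)
    then show ?thesis by (rule has_vector_derivative_at_within)
  qed
  define fx where "fx x s = Blinfun (G x s)" for x s
  have fx: "blinfun_apply (fx x s) = G x s" for x s
    by (simp add: fx_def bounded_linear_Blinfun_apply Glin)
  define F where "F x = integral (cbox 0 (1::real)) (\<lambda>s. a (s *\<^sub>R x) x)" for x
  have "(F has_derivative a x) (at x)" for x
  proof -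
    have contfx: "continuous_on (UNIV \<times> cbox 0 (1::real)) (\<lambda>(x, s). fx x s)"
    proof (rule continuous_on_blinfun_componentwise)
      fix i :: 'v assume "i \<in> Basis"
      have "G x s i = a (s *\<^sub>R x) i + s *\<^sub>R (\<Sum>b\<in>Basis. (x \<bullet> b) *\<^sub>R D (s *\<^sub>R x) i b)" for x s
        unfolding G_def using linear_expand[OF Dlin[of "s *\<^sub>R x" i], of x] by simp
      moreover have "continuous_on (UNIV \<times> cbox 0 (1::real)) (\<lambda>p. a (snd p *\<^sub>R fst p) i)"
        by (rule continuous_on_compose2[OF acont[of UNIV]]) (auto intro!: continuous_intros)
      moreover have "continuous_on (UNIV \<times> cbox 0 (1::real)) (\<lambda>p. D (snd p *\<^sub>R fst p) i b)" for b
        by (rule continuous_on_compose2[OF Dcont[of UNIV]]) (auto intro!: continuous_intros)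
      ultimately show "continuous_on (UNIV \<times> cbox 0 (1::real))
          (\<lambda>p. blinfun_apply (case p of (x, s) \<Rightarrow> fx x s) i)"
        by (auto simp: case_prod_beta fx intro!: continuous_intros)
    qed
    have "((\<lambda>x. integral (cbox 0 1) (\<lambda>s::real. a (s *\<^sub>R x) x)) has_derivative
        integral (cbox 0 1) (fx x)) (at x within UNIV)"
    proof (rule leibniz_rule[OF _ _ contfx])
      fix x and s :: real
      have "((\<lambda>x. \<Sum>b\<in>Basis. (x \<bullet> b) *\<^sub>R a (s *\<^sub>R x) b) has_derivative
          (\<lambda>w. \<Sum>b\<in>Basis. (w \<bullet> b) *\<^sub>R a (s *\<^sub>R x) b + (x \<bullet> b) *\<^sub>R D (s *\<^sub>R x) b (s *\<^sub>R w))) (at x)"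
        by (auto intro!: derivative_eq_intros has_derivative_compose[OF _ D] simp: add.commute)
      moreover have "(\<Sum>b\<in>Basis. (w \<bullet> b) *\<^sub>R a (s *\<^sub>R x) b + (x \<bullet> b) *\<^sub>R D (s *\<^sub>R x) b (s *\<^sub>R w))
          = G x s w" for w
      proof -
        have "(\<Sum>b\<in>Basis. (x \<bullet> b) *\<^sub>R D (s *\<^sub>R x) b (s *\<^sub>R w)) = D (s *\<^sub>R x) (s *\<^sub>R w) x"
          unfolding Dsym[of _ _ "s *\<^sub>R w"] by (rule linear_expand[symmetric, OF Dlin])
        also have "\<dots> = s *\<^sub>R D (s *\<^sub>R x) w x"
          using linear_cmul[OF Dlin] Dsym by metis
        finally show ?thesis
          by (simp add: sum.distrib linear_expand[OF lin, symmetric] G_def)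
      qed
      ultimately show "((\<lambda>x. a (s *\<^sub>R x) x) has_derivative blinfun_apply (fx x s)) (at x within UNIV)"
        by (simp add: fx linear_expand[OF lin, symmetric])
    next
      fix x
      have "continuous_on (cbox 0 1) (\<lambda>s::real. a (s *\<^sub>R x) x)"
        by (rule continuous_on_compose2[OF acont[of UNIV]]) (auto intro!: continuous_intros)
      then show "(\<lambda>s::real. a (s *\<^sub>R x) x) integrable_on cbox 0 1"
        by (rule integrable_continuous)
    qed auto
    moreover have "blinfun_apply (integral (cbox 0 1) (fx x)) = a x"
    proof
      fix w
      have "continuous_on (cbox 0 1) (fx x)"
        using continuous_on_compose2[OF contfx continuous_on_Pair[OF continuous_on_const[of _ x]
              continuous_on_id]]
        by auto
      then have "fx x integrable_on cbox 0 1" by (rule integrable_continuous)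
      then have "blinfun_apply (integral (cbox 0 1) (fx x)) w = integral (cbox 0 1) (\<lambda>s. G x s w)"
        by (simp add: blinfun_apply_integral fx)
      also have "\<dots> = a x w"
        using fundamental_theorem_of_calculus[of 0 1 "\<lambda>s. s *\<^sub>R a (s *\<^sub>R x) w" "\<lambda>s. G x s w"] ray
        by (auto intro!: integral_unique)
      finally show "blinfun_apply (integral (cbox 0 1) (fx x)) w = a x w" .
    qed
    ultimately show ?thesis unfolding F_def[abs_def] by simp
  qed
  then show thesis by (rule that)
qed

section \<open>Liouville's theorem along two-dimensional orbits\<close>

text \<open>
  Left-invariant directions are the right ones for growth estimates: the derivative of \<open>F\<close> along
  \<open>s \<mapsto> z exp (s v)\<close> is \<open>a (X\<^sub>v)\<close>.
\<close>

lemma growth_along_heis_exp: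
  fixes F :: "complex ^ 3 \<Rightarrow> complex"
  assumes F: "\<And>x. (F has_derivative a x) (at x)"
    and B: "\<And>z. norm (a z (lfield v z)) \<le> B"
  shows "norm (F (heis_mult z (heis_exp v s)) - F z) \<le> B * \<bar>s\<bar>"
proof -
  define c where "c s = heis_mult z (heis_exp v s)" for s
  have lin: "linear (a x)" for x using has_derivative_linear[OF F] .
  have der: "((\<lambda>s. F (c s)) has_derivative (\<lambda>h. h *\<^sub>R a (c s) (lfield v (c s)))) (at s)" for s
    using has_derivative_compose[OF has_derivative_heis_exp F, of z v s]
    by (simp add: c_def linear_cmul[OF lin])
  have "norm (F (c s) - F (c 0)) \<le> B * norm (s - 0)"
  proof (rule differentiable_bound[OF convex_UNIV der])
    fix r :: real
    show "onorm (\<lambda>h. h *\<^sub>R a (c r) (lfield v (c r))) \<le> B"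
      by (rule onorm_le) (use mult_right_mono[OF B[of "c r"] abs_ge_zero] in \<open>simp add: mult.commute\<close>)
  qed auto
  moreover have "c 0 = z"
    by (simp add: c_def heis_exp_def heis_mult_eq vec_eq_iff forall_3)
  ultimately show ?thesis by (simp add: c_def)
qed

text \<open>
  The centre is quadratically distorted: the central translation by \<open>s\<^sup>2 c\<close> is the commutator of two
  elements at distance \<open>O(s)\<close>. A primitive of a bounded form therefore grows at most like
  the square root of the distance in central directions.
\<close>

lemma growth_along_center:
  fixes F :: "complex ^ 3 \<Rightarrow> complex"
  assumes F: "\<And>x. (F has_derivative a x) (at x)"
    and bd: "\<And>v. bounded (range (\<lambda>z. a z (lfield v z)))"
  obtains B where "\<And>z s. 0 \<le> s \<Longrightarrow>
    norm (F (heis_mult z (vector [0, 0, of_real (s\<^sup>2) * c])) - F z) \<le> B * s"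
proof -
  define v w :: "complex ^ 3" where "v = vector [1, 0, 0]" and "w = vector [0, c, 0]"
  obtain Bv where Bv: "\<And>z. norm (a z (lfield v z)) \<le> Bv"
    using bd[of v] unfolding bounded_iff by auto
  obtain Bw where Bw: "\<And>z. norm (a z (lfield w z)) \<le> Bw"
    using bd[of w] unfolding bounded_iff by auto
  have "norm (F (heis_mult z (vector [0, 0, of_real (s\<^sup>2) * c])) - F z) \<le> (2 * Bv + 2 * Bw) * s"
    if s: "0 \<le> s" for z s
  proof -
    \<comment> \<open>the four corners of the commutator path\<close>
    define z1 where "z1 = heis_mult z (heis_exp v s)"
    define z2 where "z2 = heis_mult z1 (heis_exp w s)"
    define z3 where "z3 = heis_mult z2 (heis_exp v (- s))"
    define z4 where "z4 = heis_mult z3 (heis_exp w (- s))"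
    have z4: "heis_mult z (vector [0, 0, of_real (s\<^sup>2) * c]) = z4"
      by (simp add: z1_def z2_def z3_def z4_def heis_mult_eq heis_exp_def v_def w_def vec_eq_iff
          forall_3 algebra_simps power2_eq_square)
    have "norm (F z1 - F z) \<le> Bv * s" "norm (F z3 - F z2) \<le> Bv * s"
      using growth_along_heis_exp[OF F Bv, of z s] growth_along_heis_exp[OF F Bv, of z2 "- s"] s
      by (simp_all add: z1_def z3_def)
    moreover have "norm (F z2 - F z1) \<le> Bw * s" "norm (F z4 - F z3) \<le> Bw * s"
      using growth_along_heis_exp[OF F Bw, of z1 s] growth_along_heis_exp[OF F Bw, of z3 "- s"] s
      by (simp_all add: z2_def z4_def)
    moreover have "F z4 - F z = (F z4 - F z3) + (F z3 - F z2) + (F z2 - F z1) + (F z1 - F z)"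
      by simp
    then have "norm (F z4 - F z)
        \<le> norm (F z4 - F z3) + norm (F z3 - F z2) + norm (F z2 - F z1) + norm (F z1 - F z)"
      by (metis norm_triangle_le norm_triangle_ineq add_right_mono)
    ultimately show ?thesis unfolding z4 by (simp add: algebra_simps)
  qed
  then show thesis by (rule that)
qed

text \<open>
  The condition relating \<open>p\<close> and \<open>q\<close> is the Cauchy-Riemann equation for the restriction of the
  primitive \<open>F\<close> to the orbit \<open>z exp (s p + t q)\<close>. The restriction is entire with bounded derivative,
  hence affine, and slow growth in the central direction \<open>q\<close> forces the slope to vanish.
\<close>

lemma holomorphic_along_plane_zero:
  fixes F :: "complex ^ 3 \<Rightarrow> complex"
  assumes F: "\<And>x. (F has_derivative a x) (at x)"
    and bd: "\<And>v. bounded (range (\<lambda>z. a z (lfield v z)))"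
    and q: "q = vector [0, 0, c]"
    and CR: "\<And>z. a z (lfield q z) = \<i> * a z (lfield p z)"
  shows "a z (lfield p z) = 0"
proof -
  define \<Psi> where "\<Psi> w = heis_mult z (heis_mult (heis_exp p (Re w)) (of_real (Im w) *\<^sub>R q))" for w
  have \<Psi>0: "\<Psi> 0 = z"
    by (simp add: \<Psi>_def heis_exp_def heis_mult_eq vec_eq_iff forall_3)
  have lin: "linear (a x)" for x using has_derivative_linear[OF F] .
  have d\<Psi>: "(\<Psi> has_derivative
      (\<lambda>h. Re h *\<^sub>R lfield p (\<Psi> w) + Im h *\<^sub>R lfield q (\<Psi> w))) (at w)" for w
    unfolding \<Psi>_def heis_mult_eq heis_exp_def q
    by (auto intro!: derivative_eq_intros ext
        simp: lfield_def vec_eq_iff forall_3 power2_eq_square algebra_simps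
          scaleR_conv_of_real[where 'a = complex])
  define H where "H w = F (\<Psi> w)" for w
  define k where "k w = a (\<Psi> w) (lfield p (\<Psi> w))" for w
  have dH: "(H has_field_derivative k w) (at w)" for w
  proof -
    have "(H has_derivative (\<lambda>h. a (\<Psi> w) (Re h *\<^sub>R lfield p (\<Psi> w) + Im h *\<^sub>R lfield q (\<Psi> w)))) (at w)"
      unfolding H_def by (rule has_derivative_compose[OF d\<Psi> F])
    moreover have "a (\<Psi> w) (Re h *\<^sub>R lfield p (\<Psi> w) + Im h *\<^sub>R lfield q (\<Psi> w)) = k w * h" for h
    proof -
      have "Re h *\<^sub>R A + Im h *\<^sub>R (\<i> * A) = A * h" for A
        by (simp add: complex_eq_iff algebra_simps)
      then show ?thesis by (simp only: linear_add[OF lin] linear_cmul[OF lin] CR k_def)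
    qed
    ultimately show ?thesis by (simp add: has_field_derivative_def)
  qed
  have "bounded (range k)"
    by (rule bounded_subset[OF bd[of p]]) (auto simp: k_def)
  moreover have "k holomorphic_on UNIV"
  proof -
    have "H holomorphic_on UNIV" using dH by (auto simp: holomorphic_on_open)
    moreover have "deriv H = k" using dH by (auto intro: DERIV_imp_deriv)
    ultimately show ?thesis using holomorphic_deriv by blast
  qed
  ultimately have "k constant_on UNIV" by (intro Liouville_theorem)
  then obtain m where k: "k w = m" for w by (auto simp: constant_on_def)
  have "((\<lambda>w. H w - m * w) has_field_derivative 0) (at w within UNIV)" for w
    using dH[of w] unfolding k by (auto intro!: derivative_eq_intros)
  then have "\<exists>d. \<forall>w\<in>UNIV. H w - m * w = d"
    by (rule has_field_derivative_zero_constant[OF convex_UNIV])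
  then obtain d where d: "H w - m * w = d" for w by blast
  have H: "H w - H 0 = m * w" for w using d[of w] d[of 0] by (simp add: algebra_simps)
  obtain B where B: "\<And>z s. 0 \<le> s \<Longrightarrow>
      norm (F (heis_mult z (vector [0, 0, of_real (s\<^sup>2) * c])) - F z) \<le> B * s"
    using growth_along_center[OF F bd, of c] by metis
  have "norm (m) * s \<le> B" if s: "s > 0" for s
  proof -
    have "\<Psi> (\<i> * of_real (s\<^sup>2)) = heis_mult z (vector [0, 0, of_real (s\<^sup>2) * c])"
      by (simp add: \<Psi>_def heis_exp_def heis_mult_eq q vec_eq_iff forall_3 del: of_real_power
          add: scaleR_conv_of_real[where 'a = complex])
    then have "norm (H (\<i> * of_real (s\<^sup>2)) - H 0) \<le> B * s"
      using B[of s z] s by (simp add: H_def \<Psi>0)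
    then have "norm (m) * s * s \<le> B * s"
      unfolding H using s by (simp add: norm_mult power2_eq_square norm_power)
    then show ?thesis using s by simp
  qed
  moreover have "\<exists>s>0. norm (m) * s > B" if "m \<noteq> 0"
  proof (intro exI conjI)
    show "(\<bar>B\<bar> + 1) / norm (m) > 0" using that by (simp add: pos_add_strict)
    show "norm (m) * ((\<bar>B\<bar> + 1) / norm (m)) > B" using that by simp
  qed
  ultimately have "m = 0" by force
  then show ?thesis using k[of 0] by (simp add: k_def \<Psi>0)
qed

lemma ext_d_degree_1:
  "ext_d \<omega> x [v, w] = frechet_derivative (\<lambda>y. \<omega> y [w]) (at x) v
                     - frechet_derivative (\<lambda>y. \<omega> y [v]) (at x) w"
  by (simp add: ext_d_def omit_def numeral_2_eq_2)

lemma closed_form_vanishes: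
  assumes \<omega>: "\<omega> \<in> forms iwasawa_deck" and closed: "ext_d \<omega> = (\<lambda>x vs. 0)"
    and q: "q = vector [0, 0, c]"
    and CR: "\<And>z. \<omega> z [lfield q z] = \<i> * \<omega> z [lfield p z]"
  shows "\<omega> z [lfield p z] = 0"
proof -
  have sm: "smooth (\<lambda>x. \<omega> x vs)" for vs using \<omega> by (simp add: forms_def)
  obtain F where F: "\<And>x. (F has_derivative (\<lambda>v. \<omega> x [v])) (at x)"
  proof (rule closed_1_form_primitive)
    fix x v w
    show "frechet_derivative (\<lambda>y. \<omega> y [v]) (at x) w = frechet_derivative (\<lambda>y. \<omega> y [w]) (at x) v"
      using ext_d_degree_1[of \<omega> x w v] closed by simp
  qed (use \<omega> sm in \<open>auto intro: forms_linear_degree_1 smooth_differentiable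
      smooth_partial_continuous\<close>)
  show ?thesis
    by (rule holomorphic_along_plane_zero[where a = "\<lambda>x v. \<omega> x [v]", OF F _ q CR])
       (rule bounded_on_lfield[OF \<omega>])
qed

section \<open>Pure spinors of a complex structure\<close>

text \<open>
  This remnant of multilinearity survives Clifford products and is all that the computation with
  \<open>j\<^sup>2 = - 1\<close> below requires.
\<close>

definition slotwise_odd :: "('v::real_vector list \<Rightarrow> complex) \<Rightarrow> bool" where
  "slotwise_odd \<phi> \<longleftrightarrow> (\<forall>us v ws. \<phi> (us @ (- v) # ws) = - \<phi> (us @ v # ws))"

lemma slotwise_oddD: "slotwise_odd \<phi> \<Longrightarrow> \<phi> (us @ (- v) # ws) = - \<phi> (us @ v # ws)"
  by (simp add: slotwise_odd_def)

lemma slotwise_odd_Cons: "slotwise_odd \<phi> \<Longrightarrow> slotwise_odd (\<lambda>ws. \<phi> (u # ws))"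
  unfolding slotwise_odd_def by (metis append_Cons)

lemma omit_0 [simp]: "omit 0 (v # vs) = vs"
  and omit_Suc [simp]: "omit (Suc i) (v # vs) = v # omit i vs"
  by (simp_all add: omit_def)

lemma wedge1_Nil [simp]: "wedge1 \<zeta> \<phi> [] = 0"
  by (simp add: wedge1_def)

lemma wedge1_Cons: "wedge1 \<zeta> \<phi> (v # vs) = \<zeta> v * \<phi> vs - wedge1 \<zeta> (\<lambda>ws. \<phi> (v # ws)) vs"
  by (simp add: wedge1_def sum.lessThan_Suc_shift sum_negf[symmetric] del: sum.lessThan_Suc)

lemma wedge1_linear_left:
  "wedge1 (\<lambda>v. \<zeta> v + c * \<eta> v) \<phi> vs = wedge1 \<zeta> \<phi> vs + c * wedge1 \<eta> \<phi> vs"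
  by (simp add: wedge1_def sum_distrib_left sum.distrib algebra_simps)

lemma wedge1_scale_right: "wedge1 \<zeta> (\<lambda>ws. c * \<phi> ws) vs = c * wedge1 \<zeta> \<phi> vs"
  by (simp add: wedge1_def sum_distrib_left algebra_simps)

lemma wedge1_map: "wedge1 \<zeta> \<phi> (map f vs) = wedge1 (\<lambda>v. \<zeta> (f v)) (\<lambda>ws. \<phi> (map f ws)) vs"
  by (induction vs arbitrary: \<phi>) (simp_all add: wedge1_Cons)

lemma slotwise_odd_wedge1:
  assumes "\<And>v. \<zeta> (- v) = - \<zeta> v" and "slotwise_odd \<phi>"
  shows "slotwise_odd (wedge1 \<zeta> \<phi>)"
proof -
  have "wedge1 \<zeta> \<phi> (us @ (- v) # ws) = - wedge1 \<zeta> \<phi> (us @ v # ws)" for us v ws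
    using assms(2)
  proof (induction us arbitrary: \<phi>)
    case Nil
    have "(\<lambda>ws. \<phi> ((- v) # ws)) = (\<lambda>ws. (- 1) * \<phi> (v # ws))"
      using slotwise_oddD[OF Nil, of "[]"] by simp
    then show ?case by (simp only: append_Nil wedge1_Cons wedge1_scale_right assms(1)) simp
  next
    case (Cons u us)
    show ?case
      using Cons.IH[OF slotwise_odd_Cons[OF Cons.prems, of u]] slotwise_oddD[OF Cons.prems]
      by (simp add: wedge1_Cons)
  qed
  then show ?thesis by (simp add: slotwise_odd_def)
qed

lemma alternating_swap:
  assumes "alternating \<phi>"
  shows "\<phi> (us @ v # w # ws) = - \<phi> (us @ w # v # ws)"
proof -
  have lin: "linear (\<lambda>v. \<phi> (us @ v # ws))" for us ws
    using assms by (simp add: alternating_def)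
  have zero: "\<phi> (us @ v # v # ws) = 0" for v
    using assms by (auto simp: alternating_def)
  have r: "\<phi> (us @ x # (y + y') # ws) = \<phi> (us @ x # y # ws) + \<phi> (us @ x # y' # ws)" for x y y'
    using linear_add[OF lin[of "us @ [x]" ws]] by simp
  have "0 = \<phi> (us @ (v + w) # (v + w) # ws)" by (simp add: zero)
  also have "\<dots> = \<phi> (us @ v # (v + w) # ws) + \<phi> (us @ w # (v + w) # ws)"
    by (rule linear_add[OF lin])
  also have "\<dots> = \<phi> (us @ v # w # ws) + \<phi> (us @ w # v # ws)"
    by (simp add: r zero)
  finally show ?thesis by (simp add: eq_neg_iff_add_eq_0)
qed

lemma alternating_to_front:
  assumes "alternating \<phi>"
  shows "\<phi> (us @ v # ws) = (-1) ^ length us * \<phi> (v # us @ ws)"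
proof (induction us arbitrary: ws rule: rev_induct)
  case (snoc u us)
  show ?case
    using alternating_swap[OF assms, of us u v ws] snoc[of "u # ws"] by simp
qed simp

text \<open>
  Summed over \<open>i\<close> this is Euler's identity, which counts degrees in \<open>U_line_degree\<close>.
\<close>

lemma alternating_omit:
  assumes "alternating \<phi>" "i < length vs"
  shows "(-1) ^ i * \<phi> (vs ! i # omit i vs) = \<phi> vs"
proof -
  have "\<phi> vs = \<phi> (take i vs @ vs ! i # drop (Suc i) vs)"
    using assms(2) by (simp add: id_take_nth_drop[symmetric])
  also have "\<dots> = (-1) ^ i * \<phi> (vs ! i # omit i vs)"
    using assms by (simp add: alternating_to_front omit_def)
  finally show ?thesis by simp
qed

lemma alternating_slotwise_odd: "alternating \<phi> \<Longrightarrow> slotwise_odd \<phi>"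
  unfolding alternating_def slotwise_odd_def by (metis linear_neg)

lemma wedge1_diff_scale:
  "wedge1 (\<lambda>v. \<zeta> v - c * \<eta> v) \<phi> vs = wedge1 \<zeta> \<phi> vs - c * wedge1 \<eta> \<phi> vs"
  by (simp add: wedge1_def sum_distrib_left sum_subtractf algebra_simps)

context
  fixes j :: "'v::euclidean_space \<Rightarrow>\<^sub>L 'v"
  assumes sq: "\<And>v. blinfun_apply j (blinfun_apply j v) = - v"
begin

abbreviation (input) Jgen :: "'v gtangent \<Rightarrow> 'v gtangent" where
  "Jgen \<equiv> (\<lambda>(X, \<xi>). (- blinfun_apply j X, \<xi> o\<^sub>L j))"

lemma L_space_eq:
  "L_space Jgen = {((X, \<xi>), (blinfun_apply j X, - (\<xi> o\<^sub>L j))) | X \<xi>. True}"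
proof -
  have "\<xi> o\<^sub>L j o\<^sub>L j = - \<xi>" for \<xi> :: "'v \<Rightarrow>\<^sub>L real"
    by (rule blinfun_eqI) (simp add: sq blinfun.bilinear_simps)
  moreover have "- (\<xi> o\<^sub>L j) o\<^sub>L j = - (\<xi> o\<^sub>L j o\<^sub>L j)" for \<xi> :: "'v \<Rightarrow>\<^sub>L real"
    by (rule blinfun_eqI) (simp add: blinfun.bilinear_simps)
  ultimately show ?thesis
    unfolding L_space_def by (auto simp: sq minus_equation_iff[of _ "_ o\<^sub>L j"] equation_minus_iff)
qed

lemma clifford_c_L_space:
  "clifford_c ((X, \<xi>), (blinfun_apply j X, - (\<xi> o\<^sub>L j))) \<phi> vs =
     \<phi> (X # vs) + \<i> * \<phi> (blinfun_apply j X # vs) +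
     wedge1 (\<lambda>v. of_real (blinfun_apply \<xi> v) - \<i> * of_real (blinfun_apply \<xi> (blinfun_apply j v))) \<phi> vs"
proof -
  have "wedge1 (\<lambda>v. of_real (blinfun_apply (- (\<xi> o\<^sub>L j)) v)) \<phi> vs
      = - wedge1 (\<lambda>v. of_real (blinfun_apply \<xi> (blinfun_apply j v))) \<phi> vs"
    by (simp add: wedge1_def sum_negf blinfun.bilinear_simps)
  then show ?thesis
    by (simp add: clifford_c_def clifford_def wedge1_diff_scale algebra_simps)
qed

lemma clifford_c_L_bar:
  assumes "l \<in> L_bar Jgen"
  obtains X \<xi> where "\<And>\<phi> vs. clifford_c l \<phi> vs =
     \<phi> (X # vs) + \<i> * \<phi> ((- blinfun_apply j X) # vs) +
     wedge1 (\<lambda>v. of_real (blinfun_apply \<xi> v) + \<i> * of_real (blinfun_apply \<xi> (blinfun_apply j v))) \<phi> vs"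
proof -
  obtain X \<xi> where l: "l = ((X, \<xi>), - (blinfun_apply j X, - (\<xi> o\<^sub>L j)))"
    using assms unfolding L_bar_def L_space_eq by auto
  show thesis
    by (rule that[of X \<xi>])
       (simp add: l clifford_c_def clifford_def wedge1_linear_left algebra_simps)
qed

text \<open>
  Pull-back along \<open>j\<close> multiplies a form of type \<open>(p, q)\<close> by \<open>\<i>\<^sup>p\<^sup>-\<^sup>q\<close>. An element of \<open>L\<^sup>-\<close> contracts with a
  vector of type \<open>(1, 0)\<close> or multiplies by a covector of type \<open>(0, 1)\<close>; either lowers \<open>p - q\<close> by one.
  Using this multiplicative action, and not the derivation extending \<open>j\<close>, the eigenvalue is seen one
  factor at a time, without decomposing forms into types.
\<close>

lemma clifford_c_L_bar_pullback:
  assumes l: "l \<in> L_bar Jgen" and odd: "slotwise_odd \<phi>"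
    and \<kappa>: "\<And>vs. \<phi> (map (blinfun_apply j) vs) = \<kappa> * \<phi> vs"
  shows "slotwise_odd (clifford_c l \<phi>)"
    and "clifford_c l \<phi> (map (blinfun_apply j) vs) = (- \<i> * \<kappa>) * clifford_c l \<phi> vs"
proof -
  obtain X \<xi> where l: "\<And>\<phi> vs. clifford_c l \<phi> vs =
     \<phi> (X # vs) + \<i> * \<phi> ((- blinfun_apply j X) # vs) +
     wedge1 (\<lambda>v. of_real (blinfun_apply \<xi> v) + \<i> * of_real (blinfun_apply \<xi> (blinfun_apply j v))) \<phi> vs"
    using clifford_c_L_bar[OF l] by metis
  let ?\<zeta> = "\<lambda>v. of_real (blinfun_apply \<xi> v) + \<i> * of_real (blinfun_apply \<xi> (blinfun_apply j v)) :: complex"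
  have "slotwise_odd (wedge1 ?\<zeta> \<phi>)"
    by (rule slotwise_odd_wedge1[OF _ odd]) (simp add: blinfun.bilinear_simps)
  then show "slotwise_odd (clifford_c l \<phi>)"
    using slotwise_odd_Cons[OF odd] by (simp add: l slotwise_odd_def)
  have neg: "\<phi> ((- v) # vs) = - \<phi> (v # vs)" for v vs
    using slotwise_oddD[OF odd, of "[]"] by simp
  have contr: "\<phi> (v # map (blinfun_apply j) vs) = - \<kappa> * \<phi> (blinfun_apply j v # vs)" for v
  proof -
    have "\<phi> (v # map (blinfun_apply j) vs) = \<phi> (map (blinfun_apply j) ((- blinfun_apply j v) # vs))"
      by (simp add: sq blinfun.bilinear_simps)
    then show ?thesis by (simp only: \<kappa> neg) simp
  qed
  have "(\<lambda>v. ?\<zeta> (blinfun_apply j v)) = (\<lambda>v. - \<i> * ?\<zeta> v)"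
    by (auto simp: sq blinfun.bilinear_simps algebra_simps)
  then have "wedge1 ?\<zeta> \<phi> (map (blinfun_apply j) vs) = (- \<i> * \<kappa>) * wedge1 ?\<zeta> \<phi> vs"
    by (simp only: wedge1_map \<kappa> wedge1_scale_right) (simp add: wedge1_def sum_distrib_left algebra_simps)
  moreover have "\<phi> (X # map (blinfun_apply j) vs) + \<i> * \<phi> ((- blinfun_apply j X) # map (blinfun_apply j) vs)
      = (- \<i> * \<kappa>) * (\<phi> (X # vs) + \<i> * \<phi> ((- blinfun_apply j X) # vs))"
    by (simp add: contr neg sq algebra_simps blinfun.bilinear_simps)
  ultimately show "clifford_c l \<phi> (map (blinfun_apply j) vs) = (- \<i> * \<kappa>) * clifford_c l \<phi> vs"
    by (simp only: l distrib_left)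
qed

lemma foldr_clifford_pullback:
  assumes "set ls \<subseteq> L_bar Jgen" and "slotwise_odd \<phi>"
    and "\<And>vs. \<phi> (map (blinfun_apply j) vs) = \<kappa> * \<phi> vs"
  shows "slotwise_odd (foldr clifford_c ls \<phi>) \<and> (\<forall>vs. foldr clifford_c ls \<phi> (map (blinfun_apply j) vs)
      = ((- \<i>) ^ length ls * \<kappa>) * foldr clifford_c ls \<phi> vs)"
  using assms(1)
proof (induction ls)
  case Nil
  show ?case using assms by simp
next
  case (Cons l ls)
  have l: "l \<in> L_bar Jgen" and IH: "slotwise_odd (foldr clifford_c ls \<phi>)"
    "\<And>vs. foldr clifford_c ls \<phi> (map (blinfun_apply j) vs)
      = ((- \<i>) ^ length ls * \<kappa>) * foldr clifford_c ls \<phi> vs"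
    using Cons by auto
  show ?case
    using clifford_c_L_bar_pullback[OF l IH] by (simp add: mult.assoc)
qed

text \<open>
  Annihilation by the vectors \<open>X + \<i> j X\<close> of type \<open>(0, 1)\<close> makes a pure spinor complex linear in its
  first slot, hence in every slot.
\<close>

lemma U_line_contraction:
  assumes "\<phi> \<in> U_line Jgen"
  shows "\<phi> (us @ blinfun_apply j X # ws) = \<i> * \<phi> (us @ X # ws)"
proof (cases "\<phi> = (\<lambda>vs. 0)")
  case False
  have alt: "alternating \<phi>" using assms by (simp add: U_line_def)
  have "((X, 0), (blinfun_apply j X, - (0 o\<^sub>L j))) \<in> L_space Jgen"
    unfolding L_space_eq by blast
  then have "clifford_c ((X, 0), (blinfun_apply j X, - (0 o\<^sub>L j))) \<phi> = (\<lambda>vs. 0)"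
    using assms False unfolding U_line_def by blast
  then have "\<phi> (X # us @ ws) + \<i> * \<phi> (blinfun_apply j X # us @ ws) = 0"
    unfolding fun_eq_iff clifford_c_L_space by (simp add: wedge1_def)
  then have "\<phi> (blinfun_apply j X # us @ ws) = \<i> * \<phi> (X # us @ ws)"
    by (simp add: complex_eq_iff add_eq_0_iff)
  then show ?thesis by (simp add: alternating_to_front[OF alt])
qed simp

lemma U_line_wedge:
  assumes "\<phi> \<in> U_line Jgen" and "\<zeta> \<in> covectors_10 j"
  shows "wedge1 \<zeta> \<phi> vs = 0"
proof (cases "\<phi> = (\<lambda>vs. 0)")
  case True
  then show ?thesis by (simp add: wedge1_def)
next
  case False
  have lin: "linear \<zeta>" and j: "\<zeta> (blinfun_apply j v) = \<i> * \<zeta> v" for v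
    using assms(2) by (auto simp: covectors_10_def)
  define \<xi> where "\<xi> = Blinfun (\<lambda>v. Re (\<zeta> v))"
  have "bounded_linear (\<lambda>v. Re (\<zeta> v))"
    using lin linear_conv_bounded_linear bounded_linear_compose[OF bounded_linear_Re] by blast
  then have \<xi>: "blinfun_apply \<xi> v = Re (\<zeta> v)" for v
    by (simp add: \<xi>_def bounded_linear_Blinfun_apply)
  have \<zeta>: "\<zeta> = (\<lambda>v. of_real (blinfun_apply \<xi> v) - \<i> * of_real (blinfun_apply \<xi> (blinfun_apply j v)))"
    by (rule ext) (simp add: \<xi> j complex_eq_iff)
  have "((0, \<xi>), (blinfun_apply j 0, - (\<xi> o\<^sub>L j))) \<in> L_space Jgen"
    unfolding L_space_eq by blast
  then have "clifford_c ((0, \<xi>), (blinfun_apply j 0, - (\<xi> o\<^sub>L j))) \<phi> = (\<lambda>vs. 0)"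
    using assms(1) False unfolding U_line_def by blast
  then have "\<phi> (0 # vs) + \<i> * \<phi> (blinfun_apply j 0 # vs) + wedge1 \<zeta> \<phi> vs = 0"
    unfolding fun_eq_iff clifford_c_L_space \<zeta>[symmetric] by blast
  moreover have "\<phi> (0 # vs) = 0"
    using alternating_slotwise_odd[of \<phi>] assms(1) slotwise_oddD[of \<phi> "[]" 0 vs] by (simp add: U_line_def)
  ultimately show ?thesis by (simp add: blinfun.bilinear_simps)
qed

text \<open>
  Contracting \<open>\<zeta>\<^sub>i \<and> \<phi> = 0\<close> with \<open>u\<^sub>i\<close> and summing over the frame gives \<open>n \<phi> - N \<phi> = 0\<close>, where
  \<open>N = \<Sum>\<^sub>i \<zeta>\<^sub>i \<and> \<iota>(u\<^sub>i)\<close> multiplies a complex multilinear form by its degree. So a pure spinor of a complex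
  structure lives in top degree \<open>n\<close>.
\<close>

lemma U_line_degree:
  fixes \<zeta> :: "'i::finite \<Rightarrow> 'v \<Rightarrow> complex"
  assumes \<phi>: "\<phi> \<in> U_line Jgen" and \<zeta>: "\<And>i. \<zeta> i \<in> covectors_10 j"
    and one: "\<And>i. \<zeta> i (u i) = 1"
    and basis: "\<And>v. v = (\<Sum>i\<in>UNIV. Re (\<zeta> i v) *\<^sub>R u i + Im (\<zeta> i v) *\<^sub>R blinfun_apply j (u i))"
    and nz: "\<phi> vs \<noteq> 0"
  shows "length vs = CARD('i)"
proof -
  have alt: "alternating \<phi>" using \<phi> by (simp add: U_line_def)
  have lin: "linear (\<lambda>v. \<phi> (v # ws))" for ws
  proof -
    have "linear (\<lambda>v. \<phi> ([] @ v # ws))" using alt unfolding alternating_def by blast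
    then show ?thesis by simp
  qed
  have expand: "(\<Sum>i\<in>UNIV. \<zeta> i v * \<phi> (u i # ws)) = \<phi> (v # ws)" for v ws
  proof -
    have "\<phi> (v # ws) = \<phi> ((\<Sum>i\<in>UNIV. Re (\<zeta> i v) *\<^sub>R u i + Im (\<zeta> i v) *\<^sub>R blinfun_apply j (u i)) # ws)"
      using basis[of v] by simp
    also have "\<dots> = (\<Sum>i\<in>UNIV. Re (\<zeta> i v) *\<^sub>R \<phi> (u i # ws) + Im (\<zeta> i v) *\<^sub>R \<phi> (blinfun_apply j (u i) # ws))"
      by (simp add: linear_sum[OF lin] linear_add[OF lin] linear_cmul[OF lin])
    also have "\<dots> = (\<Sum>i\<in>UNIV. \<zeta> i v * \<phi> (u i # ws))"
    proof (rule sum.cong[OF refl])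
      fix i
      have "Re c *\<^sub>R x + Im c *\<^sub>R (\<i> * x) = c * x" for c x :: complex
        by (simp add: complex_eq_iff algebra_simps)
      then show "Re (\<zeta> i v) *\<^sub>R \<phi> (u i # ws) + Im (\<zeta> i v) *\<^sub>R \<phi> (blinfun_apply j (u i) # ws)
          = \<zeta> i v * \<phi> (u i # ws)"
        using U_line_contraction[OF \<phi>, of "[]"] by simp
    qed
    finally show ?thesis by simp
  qed
  have "\<phi> vs = wedge1 (\<zeta> i) (\<lambda>ws. \<phi> (u i # ws)) vs" for i
    using U_line_wedge[OF \<phi> \<zeta>[of i], of "u i # vs"] by (simp add: wedge1_Cons one)
  then have "of_nat CARD('i) * \<phi> vs = (\<Sum>i\<in>UNIV. wedge1 (\<zeta> i) (\<lambda>ws. \<phi> (u i # ws)) vs)"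
    by simp
  also have "\<dots> = (\<Sum>k<length vs. (-1) ^ k * (\<Sum>i\<in>UNIV. \<zeta> i (vs ! k) * \<phi> (u i # omit k vs)))"
    unfolding wedge1_def by (subst sum.swap) (simp add: sum_distrib_left mult.assoc)
  also have "\<dots> = of_nat (length vs) * \<phi> vs"
    by (simp add: expand alternating_omit[OF alt])
  finally show ?thesis using nz by simp
qed

lemma U_line_pullback:
  assumes "\<phi> \<in> U_line Jgen"
  shows "\<phi> (us @ map (blinfun_apply j) ws) = \<i> ^ length ws * \<phi> (us @ ws)"
proof (induction ws arbitrary: us)
  case (Cons w ws)
  show ?case
    using Cons[of "us @ [blinfun_apply j w]"] U_line_contraction[OF assms, of us w ws] by simp
qed simp

text \<open>
  On \<open>U\<^sup>k\<close> the pull-back along \<open>j\<close> is multiplication by \<open>(- \<i>)\<^sup>3\<^sup>-\<^sup>k \<i>\<^sup>3\<close>. In degree one its square is \<open>- 1\<close>,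
  so the degree-one part vanishes unless this number is \<open>\<i>\<close> or \<open>- \<i>\<close>, that is unless \<open>k\<close> is odd; for
  even \<open>k\<close> the factor in the conclusion is immaterial.
\<close>

lemma U_space_degree_1_pure:
  fixes \<zeta> :: "3 \<Rightarrow> 'v \<Rightarrow> complex"
  assumes \<zeta>: "\<And>i. \<zeta> i \<in> covectors_10 j"
    and one: "\<And>i. \<zeta> i (u i) = 1"
    and basis: "\<And>v. v = (\<Sum>i\<in>UNIV. Re (\<zeta> i v) *\<^sub>R u i + Im (\<zeta> i v) *\<^sub>R blinfun_apply j (u i))"
    and dim: "DIM('v) = 6"
    and \<alpha>: "\<alpha> \<in> U_space Jgen k"
  shows "\<alpha> [blinfun_apply j v] = (if k mod 4 = 1 then \<i> else - \<i>) * \<alpha> [v]"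
proof -
  define \<kappa> where "\<kappa> = (- \<i>) ^ nat (3 - k) * (\<i> ^ 3)"
  have gen: "slotwise_odd b \<and> b [blinfun_apply j v] = \<kappa> * b [v]"
    if b: "b \<in> {foldr clifford_c ls \<phi> | ls \<phi>.
       int (length ls) = int (DIM('v) div 2) - k \<and> set ls \<subseteq> L_bar Jgen \<and> \<phi> \<in> U_line Jgen}" for b v
  proof -
    obtain ls \<phi> where b: "b = foldr clifford_c ls \<phi>" and len: "int (length ls) = 3 - k"
      and ls: "set ls \<subseteq> L_bar Jgen" and \<phi>: "\<phi> \<in> U_line Jgen"
      using b dim by auto
    have "\<phi> (map (blinfun_apply j) vs) = \<i> ^ 3 * \<phi> vs" for vs
      using U_line_pullback[OF \<phi>, of "[]" vs] U_line_degree[OF \<phi> \<zeta> one basis, of vs]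
      by (cases "\<phi> vs = 0") auto
    moreover have "slotwise_odd \<phi>" using \<phi> by (simp add: U_line_def alternating_slotwise_odd)
    moreover have "length ls = nat (3 - k)" using len by simp
    ultimately show ?thesis
      using foldr_clifford_pullback[OF ls, of \<phi> "\<i> ^ 3"] unfolding b \<kappa>_def
      by (metis list.map)
  qed
  obtain n c b where \<alpha>: "\<alpha> = (\<lambda>s. \<Sum>i<(n::nat). c i * b i s)"
    and b: "\<forall>i<n. b i \<in> {foldr clifford_c ls \<phi> | ls \<phi>.
       int (length ls) = int (DIM('v) div 2) - k \<and> set ls \<subseteq> L_bar Jgen \<and> \<phi> \<in> U_line Jgen}"
    using \<alpha> unfolding U_space_def cspan_def by blast
  have \<kappa>: "\<alpha> [blinfun_apply j v] = \<kappa> * \<alpha> [v]" for v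
    using b gen by (auto simp: \<alpha> sum_distrib_left intro!: sum.cong)
  have neg: "\<alpha> [- v] = - \<alpha> [v]" for v
  proof -
    have "b i [- v] = - b i [v]" if "i < n" for i
      using b gen that slotwise_oddD[of "b i" "[]" v "[]"] by simp
    then show ?thesis by (simp add: \<alpha> sum_negf[symmetric])
  qed
  have sq_\<kappa>: "- \<alpha> [v] = \<kappa> * \<kappa> * \<alpha> [v]"
    using \<kappa>[of "blinfun_apply j v"] \<kappa>[of v] by (simp add: sq neg)
  show ?thesis
  proof (cases "k \<le> 3")
    case False
    then have "n = 0" using b dim by (cases n) auto
    then show ?thesis by (simp add: \<alpha>)
  next
    case True
    define r where "r = nat (3 - k) mod 4"
    have "(- \<i>) ^ nat (3 - k) = (- \<i>) ^ (4 * (nat (3 - k) div 4) + r)"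
      by (simp add: r_def)
    also have "\<dots> = (- \<i>) ^ r"
      unfolding power_add power_mult by (simp add: power4_eq_xxxx)
    finally have \<kappa>r: "\<kappa> = (- \<i>) ^ r * \<i> ^ 3" by (simp add: \<kappa>_def)
    obtain m where m: "k = 3 - int m" using True zle_iff_zadd[of k 3] by force
    have k_r: "k mod 4 = 1 \<longleftrightarrow> r = 2" unfolding r_def m by simp presburger
    have "r < 4" by (simp add: r_def)
    then have "r = 0 \<or> r = 1 \<or> r = 2 \<or> r = 3" by linarith
    then consider "r = 0" | "r = 2" | "\<kappa> * \<kappa> = 1"
      by (auto simp: \<kappa>r power3_eq_cube)
    then show ?thesis
    proof cases
      case 3
      then have "\<alpha> [v] = 0" using sq_\<kappa> by (simp add: equation_minus_iff[of "\<alpha> [v]"] neg_equal_zero)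
      then show ?thesis by (simp add: \<kappa>)
    qed (use \<kappa>[of v] k_r in \<open>simp_all add: \<kappa>r power3_eq_cube\<close>)
  qed
qed

end

section \<open>Cohomology classes with pure representatives\<close>

text \<open>
  Only the degree-one part is constrained, and the same type is required at all points. The condition
  also covers forms whose degree-one part vanishes, such as elements of \<open>U\<^sup>k\<close> for even \<open>k\<close>.
\<close>

definition pure_closed_1 :: "('v::euclidean_space \<Rightarrow> 'v) set \<Rightarrow> ('v \<Rightarrow> 'v \<Rightarrow>\<^sub>L 'v) \<Rightarrow> 'v form set" where
  "pure_closed_1 D J = {\<alpha> \<in> closed_forms D. \<exists>\<kappa>\<in>{\<i>, - \<i>}.
     \<forall>x v. \<alpha> x [blinfun_apply (J x) v] = \<kappa> * \<alpha> x [v]}"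

text \<open>
  What remains of exactness on a compact quotient in degree one: the degree-one part is the
  differential of a function that is bounded on the covering space.
\<close>

definition bounded_primitive :: "'v::euclidean_space form \<Rightarrow> bool" where
  "bounded_primitive \<beta> \<longleftrightarrow> (\<exists>g::'v \<Rightarrow> complex. bounded (range g) \<and>
     (\<forall>x. (g has_derivative (\<lambda>v. \<beta> x [v])) (at x)))"

lemma bounded_primitive_add:
  assumes "bounded_primitive \<beta>" "bounded_primitive \<gamma>"
  shows "bounded_primitive (\<lambda>x vs. \<beta> x vs + \<gamma> x vs)"
proof -
  obtain g h where "bounded (range g)" "\<And>x. (g has_derivative (\<lambda>v. \<beta> x [v])) (at x)"
    "bounded (range h)" "\<And>x. (h has_derivative (\<lambda>v. \<gamma> x [v])) (at x)"
    using assms unfolding bounded_primitive_def by blast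
  then show ?thesis
    unfolding bounded_primitive_def
    by (intro exI[of _ "\<lambda>x. g x + h x"]) (auto intro: bounded_plus_comp has_derivative_add)
qed

lemma bounded_primitive_sum:
  assumes "finite F" "\<And>i. i \<in> F \<Longrightarrow> bounded_primitive (\<beta> i)"
  shows "bounded_primitive (\<lambda>x vs. \<Sum>i\<in>F. \<beta> i x vs)"
  using assms
proof (induction F)
  case empty
  show ?case unfolding bounded_primitive_def by (auto intro!: exI[of _ "\<lambda>x. 0"])
next
  case (insert i F)
  then show ?case using bounded_primitive_add[of "\<beta> i"] by simp
qed

lemma C_k_zero: "C_k n (\<lambda>x. 0)"
  by (induction n) (simp_all add: frechet_derivative_const)

lemma exact_1_forms_subset: "exact_k_forms D 1 \<subseteq> exact_forms D"
  by (auto simp: exact_forms_def exact_k_forms_def k_forms_def)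

lemma zero_in_exact_forms:
  fixes D :: "('v::euclidean_space \<Rightarrow> 'v) set"
  shows "(\<lambda>x vs. 0) \<in> exact_k_forms D 1" "(\<lambda>x vs. 0) \<in> exact_forms D"
proof -
  have "(\<lambda>x vs. 0) \<in> k_forms D 0"
    unfolding k_forms_def forms_def alternating_def smooth_def invariant_form_def pullback_def
    by (auto simp: C_k_zero linear_zero)
  then have "ext_d (\<lambda>x vs. 0) \<in> ext_d ` k_forms D 0" by (rule imageI)
  moreover have "ext_d (\<lambda>x vs. 0) = (\<lambda>(x :: 'v) vs. 0)"
    unfolding ext_d_def by (simp add: frechet_derivative_const)
  ultimately show exact: "(\<lambda>x vs. 0) \<in> exact_k_forms D 1" by (simp add: exact_k_forms_def)
  show "(\<lambda>x vs. 0) \<in> exact_forms D" by (rule subsetD[OF exact_1_forms_subset exact])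
qed

lemma bounded_primitive_exact:
  assumes "\<beta> \<in> exact_forms iwasawa_deck"
  shows "bounded_primitive \<beta>"
proof -
  obtain \<eta> where \<beta>: "\<beta> = ext_d \<eta>" and \<eta>: "\<eta> \<in> forms iwasawa_deck"
    using assms by (auto simp: exact_forms_def)
  have "(\<lambda>x. \<eta> x []) differentiable (at x)" for x
    using \<eta> by (auto simp: forms_def intro: smooth_differentiable)
  then have "((\<lambda>x. \<eta> x []) has_derivative frechet_derivative (\<lambda>x. \<eta> x []) (at x)) (at x)" for x
    using frechet_derivative_works by blast
  moreover have "frechet_derivative (\<lambda>x. \<eta> x []) (at x) = (\<lambda>v. \<beta> x [v])" for x
    by (simp add: \<beta> ext_d_def)
  ultimately have "((\<lambda>x. \<eta> x []) has_derivative (\<lambda>v. \<beta> x [v])) (at x)" for x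
    by simp
  then show ?thesis
    using bounded_function_part[OF \<eta>] unfolding bounded_primitive_def by blast
qed

text \<open>
  This serves both notions of fullness: a sum decomposition of cosets becomes an identity of forms
  between pure closed representatives, up to a term with bounded primitive.
\<close>

lemma sum_of_subspaces_representatives:
  fixes I :: "'i set"
  assumes mem: "coh_class B \<eta> \<in> sum_of_subspaces B I W"
    and zero: "(\<lambda>x vs. 0) \<in> B"
    and prim: "\<And>\<beta>. \<beta> \<in> B \<Longrightarrow> bounded_primitive \<beta>"
    and W: "\<And>i. i \<in> I \<Longrightarrow> W i \<subseteq> coh_class B ` C"
  obtains F :: "'i set" and \<alpha> \<beta> where "finite F" "\<And>i. i \<in> F \<Longrightarrow> \<alpha> i \<in> C" "bounded_primitive \<beta>"
    "\<And>x vs. \<eta> x vs = (\<Sum>i\<in>F. \<alpha> i x vs) + \<beta> x vs"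
proof -
  have diff: "(\<lambda>x vs. \<gamma> x vs - \<gamma>' x vs) \<in> B" if "coh_class B \<gamma> = coh_class B \<gamma>'" for \<gamma> \<gamma>'
  proof -
    have "\<gamma> \<in> coh_class B \<gamma>" using zero by (simp add: coh_class_def)
    then show ?thesis unfolding that by (simp add: coh_class_def)
  qed
  obtain F \<alpha> where \<eta>: "coh_class B \<eta> = coh_class B (\<lambda>x vs. \<Sum>i\<in>F. \<alpha> i x vs)"
    and F: "finite F" "F \<subseteq> I" and \<alpha>: "\<And>i. i \<in> F \<Longrightarrow> coh_class B (\<alpha> i) \<in> W i"
    using mem unfolding sum_of_subspaces_def by auto
  have "\<exists>\<gamma>. \<gamma> \<in> C \<and> coh_class B (\<alpha> i) = coh_class B \<gamma>" if "i \<in> F" for i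
    using \<alpha>[OF that] W[of i] F that by blast
  then obtain \<gamma> where \<gamma>: "\<And>i. i \<in> F \<Longrightarrow> \<gamma> i \<in> C"
      "\<And>i. i \<in> F \<Longrightarrow> coh_class B (\<alpha> i) = coh_class B (\<gamma> i)"
    by metis
  show thesis
  proof (rule that[of F \<gamma>])
    show "bounded_primitive (\<lambda>x vs. (\<eta> x vs - (\<Sum>i\<in>F. \<alpha> i x vs)) + (\<Sum>i\<in>F. \<alpha> i x vs - \<gamma> i x vs))"
      by (intro bounded_primitive_add bounded_primitive_sum prim diff F \<eta> \<gamma>)
    show "\<eta> x vs = (\<Sum>i\<in>F. \<gamma> i x vs) + ((\<eta> x vs - (\<Sum>i\<in>F. \<alpha> i x vs)) + (\<Sum>i\<in>F. \<alpha> i x vs - \<gamma> i x vs))"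
      for x vs
      by (simp add: sum_subtractf)
  qed (use F \<gamma> in auto)
qed

lemma Lambda_pq_degree_1:
  assumes "\<phi> \<in> Lambda_pq j p q" "p + q = 1"
  shows "\<phi> [blinfun_apply j v] = (if p = 1 then \<i> else - \<i>) * \<phi> [v]"
proof -
  obtain n c b where \<phi>: "\<phi> = (\<lambda>s. \<Sum>i<(n::nat). c i * b i s)"
    and b: "\<forall>i<n. b i \<in> {foldr wedge1 (as @ bs) unit_form | as bs.
     length as = p \<and> set as \<subseteq> covectors_10 j \<and> length bs = q \<and> set bs \<subseteq> covectors_01 j}"
    using assms(1) unfolding Lambda_pq_def cspan_def by blast
  have "b i [blinfun_apply j v] = (if p = 1 then \<i> else - \<i>) * b i [v]" if "i < n" for i
  proof -
    obtain as bs where bi: "b i = foldr wedge1 (as @ bs) unit_form" and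
      as: "length as = p" "set as \<subseteq> covectors_10 j" and
      bs: "length bs = q" "set bs \<subseteq> covectors_01 j"
      using b \<open>i < n\<close> by blast
    have one: "wedge1 \<xi> unit_form [v] = \<xi> v" for \<xi> and v :: 'a
      by (simp add: wedge1_Cons unit_form_def)
    consider "p = 1" "q = 0" | "p = 0" "q = 1" using assms(2) by linarith
    then show ?thesis
    proof cases
      case 1
      then obtain \<xi> where "as = [\<xi>]" "bs = []" using as bs by (auto simp: length_Suc_conv)
      then show ?thesis using as 1 by (simp add: bi one covectors_10_def)
    next
      case 2
      then obtain \<xi> where "as = []" "bs = [\<xi>]" using as bs by (auto simp: length_Suc_conv)
      then show ?thesis using bs 2 by (simp add: bi one covectors_01_def)
    qed
  qed
  then show ?thesis by (simp add: \<phi> sum_distrib_left mult.left_commute)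
qed

lemma H_pq_pure:
  assumes "p + q = 1"
  shows "H_pq D J p q \<subseteq> coh_class (exact_k_forms D 1) ` pure_closed_1 D J"
proof
  fix h assume "h \<in> H_pq D J p q"
  then obtain \<alpha> where h: "h = coh_class (exact_k_forms D 1) \<alpha>" and "\<alpha> \<in> closed_k_forms D 1"
    and pq: "\<And>x. \<alpha> x \<in> Lambda_pq (J x) p q"
    using assms unfolding H_pq_def by auto
  then have "\<alpha> \<in> closed_forms D" by (auto simp: closed_k_forms_def closed_forms_def k_forms_def)
  moreover have "\<forall>x v. \<alpha> x [blinfun_apply (J x) v] = (if p = 1 then \<i> else - \<i>) * \<alpha> x [v]"
    using Lambda_pq_degree_1[OF pq assms] by blast
  ultimately have "\<alpha> \<in> pure_closed_1 D J" unfolding pure_closed_1_def by auto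
  then show "h \<in> coh_class (exact_k_forms D 1) ` pure_closed_1 D J" unfolding h by (rule imageI)
qed

section \<open>The coframe and the complex structures\<close>

lemma coframe_lfield:
  assumes "left_invariant_coframe e" "k \<in> {1..6}"
  shows "blinfun_apply (e k z) (lfield v z) = blinfun_apply (e k 0) v"
proof -
  have "invariant_form left_translations (real_1_form (e k))"
    using assms by (simp add: left_invariant_coframe_def)
  from invariant_form_lfield[OF this, of z 0 "[v]"] show ?thesis
    by (simp add: left_translations_def real_1_form_def covector_form_def)
qed

lemma coframe_left_invariant_value:
  assumes "left_invariant_coframe e" "k \<in> {1..6}"
  shows "blinfun_apply (e k y) w = blinfun_apply (e k 0) (vector [w $ 1, w $ 2, w $ 3 - y $ 1 * w $ 2])"
proof -
  have "w = lfield (vector [w $ 1, w $ 2, w $ 3 - y $ 1 * w $ 2]) y"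
    by (simp add: lfield_def vec_eq_iff forall_3)
  then show ?thesis using coframe_lfield[OF assms] by metis
qed

text \<open>
  The differential of a left-invariant form is \<open>- e [v, w]\<close> on left-invariant fields, and every central
  direction is a bracket: \<open>(0, 0, c)\<close> is the one of \<open>(1, 0, 0)\<close> and \<open>(0, c, 0)\<close>.
\<close>

lemma closed_coframe_center:
  assumes coframe: "left_invariant_coframe e" "k \<in> {1..6}"
    and closed: "ext_d (real_1_form (e k)) = (\<lambda>x vs. 0)"
  shows "blinfun_apply (e k 0) (vector [0, 0, c]) = 0"
proof -
  have der: "frechet_derivative (\<lambda>y. real_1_form (e k) y [w]) (at 0) v
      = of_real (blinfun_apply (e k 0) (vector [0, 0, - (v $ 1 * w $ 2)]))" for v w
  proof -
    have "((\<lambda>y :: complex ^ 3. of_real (blinfun_apply (e k 0) (vector [w $ 1, w $ 2, w $ 3 - y $ 1 * w $ 2])) :: complex)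
        has_derivative (\<lambda>v. of_real (blinfun_apply (e k 0) (vector [0, 0, - (v $ 1 * w $ 2)])))) (at 0)"
      by (auto intro!: derivative_eq_intros simp: fun_eq_iff)
    from frechet_derivative_at[OF this] show ?thesis
      by (simp add: real_1_form_def covector_form_def coframe_left_invariant_value[OF coframe, of _ w] fun_eq_iff)
  qed
  have "ext_d (real_1_form (e k)) 0 [vector [0, 1, 0], vector [c, 0, 0]] = 0"
    using closed by simp
  moreover have "vector [0, 0, 0] = (0 :: complex ^ 3)" by (simp add: vec_eq_iff forall_3)
  moreover have "vector [0, 0, - c] = - (vector [0, 0, c] :: complex ^ 3)" by (simp add: vec_eq_iff forall_3)
  ultimately show ?thesis
    unfolding ext_d_degree_1 der by (simp add: blinfun.bilinear_simps)
qed

lemma coframe_separates: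
  assumes "left_invariant_coframe e" and "\<And>k. k \<in> {1..6} \<Longrightarrow> blinfun_apply (e k x) v = 0"
  shows "v = 0"
proof -
  have "blinfun_apply l v = 0" for l :: "(complex ^ 3) \<Rightarrow>\<^sub>L real"
  proof (rule span_induct[of l "(\<lambda>k. e k x) ` {1..6}" "\<lambda>l. blinfun_apply l v = 0"])
    show "l \<in> span ((\<lambda>k. e k x) ` {1..6})"
      using assms(1) by (simp add: left_invariant_coframe_def)
    show "subspace {l. blinfun_apply l v = 0}"
      by (auto simp: subspace_def blinfun.bilinear_simps)
  qed (use assms(2) in auto)
  then have "blinfun_apply (blinfun_inner_left v) v = 0" by blast
  then show ?thesis by simp
qed

lemma real_1_form_coframe_closed:
  assumes coframe: "left_invariant_coframe e" "k \<in> {1..6}"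
    and closed: "ext_d (real_1_form (e k)) = (\<lambda>x vs. 0)"
  shows "real_1_form (e k) \<in> closed_k_forms iwasawa_deck 1"
    and "real_1_form (e k) \<in> closed_forms iwasawa_deck"
proof -
  have sm: "smooth (e k)" and inv: "invariant_form left_translations (real_1_form (e k))"
    using coframe by (auto simp: left_invariant_coframe_def)
  have "alternating (real_1_form (e k) x)" for x
  proof -
    have "linear (\<lambda>v. real_1_form (e k) x (us @ v # ws))" for us ws
    proof (cases "us @ ws = []")
      case True
      then show ?thesis
        by (auto simp: real_1_form_def covector_form_def blinfun.bilinear_simps
            scaleR_conv_of_real[where 'a = complex] intro!: linearI)
    next
      case False
      then have "real_1_form (e k) x (us @ v # ws) = 0" for v
        by (auto simp: real_1_form_def covector_form_def)
      then show ?thesis by (simp add: linear_zero)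
    qed
    moreover have "real_1_form (e k) x vs = 0" if "\<not> distinct vs" for vs
      using that by (cases vs rule: remdups_adj.cases) (auto simp: real_1_form_def covector_form_def)
    ultimately show ?thesis by (simp add: alternating_def)
  qed
  moreover have "smooth (\<lambda>x. real_1_form (e k) x vs)" for vs
  proof (cases "length vs = 1")
    case True
    have "bounded_linear (\<lambda>l :: (complex ^ 3) \<Rightarrow>\<^sub>L real. of_real (blinfun_apply l (hd vs)) :: complex)"
      by (intro bounded_linear_compose[OF bounded_linear_of_real] blinfun.bounded_linear_left)
    from C_k_bounded_linear[OF this, of _ "e k"] sm show ?thesis
      using True by (simp add: smooth_def real_1_form_def covector_form_def)
  qed (simp add: real_1_form_def covector_form_def smooth_def C_k_zero)
  moreover have "invariant_form iwasawa_deck (real_1_form (e k))"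
    using inv by (auto simp: invariant_form_def iwasawa_deck_def left_translations_def)
  ultimately have "real_1_form (e k) \<in> k_forms iwasawa_deck 1"
    by (simp add: k_forms_def forms_def) (simp add: real_1_form_def covector_form_def)
  with closed show "real_1_form (e k) \<in> closed_k_forms iwasawa_deck 1"
    "real_1_form (e k) \<in> closed_forms iwasawa_deck"
    by (auto simp: closed_k_forms_def closed_forms_def k_forms_def)
qed

lemma cspan_base: "b \<in> S \<Longrightarrow> b \<in> cspan S"
  unfolding cspan_def by (auto intro!: exI[of _ "1::nat"] exI[of _ "\<lambda>_. 1"] exI[of _ "\<lambda>_. b"])

locale iwasawa_path =
  fixes e :: "nat \<Rightarrow> complex ^ 3 \<Rightarrow> (complex ^ 3) \<Rightarrow>\<^sub>L real"
    and J :: "complex ^ 3 \<Rightarrow> (complex ^ 3) \<Rightarrow>\<^sub>L (complex ^ 3)"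
    and t :: real
  assumes coframe: "left_invariant_coframe e"
    and structure_eqs: "iwasawa_structure_equations e"
    and ac: "almost_complex iwasawa_deck J"
    and J10: "\<And>x. covectors_10 (J x) = cspan {phi1 e t x, phi2 e t x, phi3 e t x}"
begin

text \<open>
  The isomorphism of the tangent space with \<open>\<complex>\<^sup>3\<close> given by the \<open>(1, 0)\<close>-coframe; it carries \<open>J\<close> to
  multiplication by \<open>\<i>\<close>.
\<close>

definition phi_coords :: "complex ^ 3 \<Rightarrow> complex ^ 3 \<Rightarrow> complex ^ 3" where
  "phi_coords x v = vector [phi1 e t x v, phi2 e t x v, phi3 e t x v]"

lemma phi_10:
  "phi1 e t x \<in> covectors_10 (J x)" "phi2 e t x \<in> covectors_10 (J x)" "phi3 e t x \<in> covectors_10 (J x)"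
  unfolding J10 by (auto intro: cspan_base)

lemma phi_coords_10: "(\<lambda>v. phi_coords x v $ i) \<in> covectors_10 (J x)"
proof -
  have "\<forall>i. (\<lambda>v. phi_coords x v $ i) \<in> covectors_10 (J x)"
    unfolding forall_3 phi_coords_def using phi_10[of x] by simp
  then show ?thesis by blast
qed

lemma linear_phi_coords: "linear (phi_coords x)"
  using phi_coords_10[of x] unfolding covectors_10_def linear_iff by (simp add: vec_eq_iff)

lemma phi_coords_J: "phi_coords x (blinfun_apply (J x) v) $ i = \<i> * phi_coords x v $ i"
  using phi_coords_10[of x i] by (simp add: covectors_10_def)

lemma inj_phi_coords: "inj (phi_coords x)"
proof (rule linear_injective_0[OF linear_phi_coords, THEN iffD2], intro allI impI)
  fix v assume "phi_coords x v = 0"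
  then have phi: "phi1 e t x v = 0" "phi2 e t x v = 0" "phi3 e t x v = 0"
    by (simp_all add: phi_coords_def vec_eq_iff forall_3)
  let ?E = "\<lambda>k. blinfun_apply (e k x) v"
  have 1: "?E 1 = 0" "?E 2 = 0" using phi(1) by (simp_all add: phi1_def complex_eq_iff)
  have 2: "?E 3 = 0" "cos (pi * t) * ?E 4 + sin (pi * t) * ?E 6 = 0"
    using phi(2) by (simp_all add: phi2_def complex_eq_iff)
  have 3: "?E 5 = 0" "sin (pi * t) * ?E 4 - cos (pi * t) * ?E 6 = 0"
    using phi(3) by (simp_all add: phi3_def complex_eq_iff)
  have "(c * a + s * b)\<^sup>2 + (s * a - c * b)\<^sup>2 = (s\<^sup>2 + c\<^sup>2) * (a\<^sup>2 + b\<^sup>2)" for a b c s :: real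
    by (simp add: power2_eq_square algebra_simps)
  from this[of "cos (pi * t)" "?E 4" "sin (pi * t)" "?E 6"]
  have "(?E 4)\<^sup>2 + (?E 6)\<^sup>2 = 0" unfolding 2 3 by simp
  then have "?E 4 = 0" "?E 6 = 0" by (simp_all add: sum_power2_eq_zero_iff)
  then have "?E k = 0" if "k \<in> {1..6}" for k
  proof -
    have "k = 1 \<or> k = 2 \<or> k = 3 \<or> k = 4 \<or> k = 5 \<or> k = 6" using that by auto
    then show ?thesis using 1 2 3 \<open>?E 4 = 0\<close> \<open>?E 6 = 0\<close> by blast
  qed
  then show "v = 0" by (rule coframe_separates[OF coframe])
qed

lemma surj_phi_coords: "surj (phi_coords x)"
  by (rule linear_injective_imp_surjective[OF linear_phi_coords inj_phi_coords refl])

lemma GH_k_pure: "GH_k iwasawa_deck (gen_of_complex J) k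
    \<subseteq> coh_class (exact_forms iwasawa_deck) ` pure_closed_1 iwasawa_deck J"
proof
  fix h assume "h \<in> GH_k iwasawa_deck (gen_of_complex J) k"
  then obtain \<alpha> where h: "h = coh_class (exact_forms iwasawa_deck) \<alpha>"
    and \<alpha>: "\<alpha> \<in> closed_forms iwasawa_deck" and U: "\<And>x. \<alpha> x \<in> U_space (gen_of_complex J x) k"
    unfolding GH_k_def by blast
  have sq: "blinfun_apply (J x) (blinfun_apply (J x) v) = - v" for x v
    using ac unfolding almost_complex_def
    by (metis blinfun_apply_blinfun_compose id_blinfun.rep_eq uminus_blinfun.rep_eq)
  have "\<alpha> x [blinfun_apply (J x) v] = (if k mod 4 = 1 then \<i> else - \<i>) * \<alpha> x [v]" for x v
  proof -
    have "\<exists>u. phi_coords x u = axis i 1" for i using surj_phi_coords by (metis surjD)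
    then obtain u where u: "\<And>i. phi_coords x (u i) = axis i 1" by metis
    show ?thesis
    proof (rule U_space_degree_1_pure[OF sq phi_coords_10])
      show "phi_coords x (u i) $ i = 1" for i by (simp add: u)
      show "w = (\<Sum>i\<in>UNIV. Re (phi_coords x w $ i) *\<^sub>R u i + Im (phi_coords x w $ i) *\<^sub>R blinfun_apply (J x) (u i))" for w
      proof (rule injD[OF inj_phi_coords[of x]])
        show "phi_coords x w = phi_coords x (\<Sum>i\<in>UNIV. Re (phi_coords x w $ i) *\<^sub>R u i + Im (phi_coords x w $ i) *\<^sub>R blinfun_apply (J x) (u i))"
          by (simp add: linear_add[OF linear_phi_coords] linear_cmul[OF linear_phi_coords] sum_3 vec_eq_iff forall_3
              phi_coords_J u axis_def complex_eq_iff)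
      qed
      show "\<alpha> x \<in> U_space (\<lambda>(X, \<xi>). (- blinfun_apply (J x) X, \<xi> o\<^sub>L J x)) k"
        using U[of x] by (simp add: gen_of_complex_def)
    qed simp
  qed
  then have "\<alpha> \<in> pure_closed_1 iwasawa_deck J" using \<alpha> unfolding pure_closed_1_def by auto
  then show "h \<in> coh_class (exact_forms iwasawa_deck) ` pure_closed_1 iwasawa_deck J"
    unfolding h by (rule imageI)
qed

lemma closed_1234: "k \<in> {1..4} \<Longrightarrow> ext_d (real_1_form (e k)) = (\<lambda>x vs. 0)"
  using structure_eqs by (simp add: iwasawa_structure_equations_def)

text \<open>
  In terms of the dual frame, \<open>p = sin (\<pi> t) e\<^sub>3 + cos (\<pi> t) e\<^sub>5\<close>, which \<open>J\<close> sends to \<open>e\<^sub>6\<close>. The latter is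
  central, because \<open>e\<^sup>1, \<dots>, e\<^sup>4\<close> vanish on the centre and \<open>e\<^sup>5, e\<^sup>6\<close> are therefore coordinates on it.
\<close>

lemma central_direction:
  obtains p c where "\<And>z. blinfun_apply (J z) (lfield p z) = vector [0, 0, c]"
    and "\<And>z. blinfun_apply (e 3 z) (lfield p z) = sin (pi * t)"
proof -
  obtain p where p: "phi_coords 0 p = vector [0, of_real (sin (pi * t)), of_real (cos (pi * t))]"
    using surj_phi_coords by (metis surjD)
  have center: "blinfun_apply (e k 0) (vector [0, 0, c]) = 0" if "k \<in> {1..4}" for k c
    by (rule closed_coframe_center[OF coframe _ closed_1234[OF that]]) (use that in auto)
  define S where "S c = Complex (blinfun_apply (e 5 0) (vector [0, 0, c])) (blinfun_apply (e 6 0) (vector [0, 0, c]))"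
    for c
  have vec_lin: "linear (\<lambda>c. vector [0, 0, c] :: complex ^ 3)"
    by (rule linearI) (auto simp: vec_eq_iff forall_3)
  have "linear S"
    by (rule linearI)
       (simp_all add: S_def complex_eq_iff linear_add[OF vec_lin] linear_cmul[OF vec_lin] blinfun.bilinear_simps)
  moreover have "inj S"
  proof (rule linear_injective_0[OF \<open>linear S\<close>, THEN iffD2], intro allI impI)
    fix c assume "S c = 0"
    then have "blinfun_apply (e 5 0) (vector [0, 0, c]) = 0" "blinfun_apply (e 6 0) (vector [0, 0, c]) = 0"
      by (simp_all add: S_def complex_eq_iff)
    moreover have "k \<in> {1..4} \<or> k = 5 \<or> k = 6" if "k \<in> {1..6}" for k :: nat using that by auto
    ultimately have "blinfun_apply (e k 0) (vector [0, 0, c]) = 0" if "k \<in> {1..6}" for k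
      using that center by blast
    then have "vector [0, 0, c] = (0 :: complex ^ 3)" by (rule coframe_separates[OF coframe])
    then show "c = 0" by (simp add: vec_eq_iff forall_3)
  qed
  ultimately have "surj S" by (rule linear_injective_imp_surjective[OF _ _ refl])
  then obtain c where c: "S c = \<i>" by (metis surjD)
  define q :: "complex ^ 3" where "q = vector [0, 0, c]"
  have e56: "blinfun_apply (e 5 0) q = 0" "blinfun_apply (e 6 0) q = 1"
    using c by (simp_all add: S_def q_def complex_eq_iff)
  have e1234: "blinfun_apply (e k 0) q = 0" if "k \<in> {1..4}" for k
    using center[OF that] by (simp add: q_def)
  have Tl: "phi_coords z (lfield v z) = phi_coords 0 v" for z v
    by (simp add: phi_coords_def phi1_def phi2_def phi3_def coframe_lfield[OF coframe])
  have "phi_coords 0 q $ i = \<i> * phi_coords 0 p $ i" for i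
  proof -
    have "\<forall>i. phi_coords 0 q $ i = \<i> * phi_coords 0 p $ i"
      unfolding p forall_3 by (simp add: phi_coords_def phi1_def phi2_def phi3_def e56 e1234)
    then show ?thesis by blast
  qed
  then have "phi_coords z (blinfun_apply (J z) (lfield p z)) = phi_coords z (lfield q z)" for z
    unfolding vec_eq_iff phi_coords_J Tl by simp
  then have "blinfun_apply (J z) (lfield p z) = vector [0, 0, c]" for z
    using injD[OF inj_phi_coords] by (metis q_def lfield_center)
  moreover have "phi2 e t 0 p = of_real (sin (pi * t))"
    using p by (simp add: phi_coords_def vec_eq_iff forall_3)
  then have "blinfun_apply (e 3 0) p = sin (pi * t)"
    by (simp add: phi2_def complex_eq_iff)
  then have "blinfun_apply (e 3 z) (lfield p z) = sin (pi * t)" for z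
    using coframe_lfield[OF coframe, of 3 z p] by simp
  ultimately show thesis by (rule that)
qed

text \<open>
  Type \<open>(0, 1)\<close> reduces to type \<open>(1, 0)\<close> by reversing the central direction.
\<close>

lemma pure_closed_vanishes:
  assumes Jp: "\<And>z. blinfun_apply (J z) (lfield p z) = vector [0, 0, c]"
    and \<alpha>: "\<alpha> \<in> pure_closed_1 iwasawa_deck J"
  shows "\<alpha> z [lfield p z] = 0"
proof -
  obtain \<kappa> where \<kappa>: "\<kappa> \<in> {\<i>, - \<i>}" and pure: "\<And>x v. \<alpha> x [blinfun_apply (J x) v] = \<kappa> * \<alpha> x [v]"
    and forms: "\<alpha> \<in> forms iwasawa_deck" and closed: "ext_d \<alpha> = (\<lambda>x vs. 0)"
    using \<alpha> unfolding pure_closed_1_def closed_forms_def by blast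
  have q: "\<alpha> z [vector [0, 0, c]] = \<kappa> * \<alpha> z [lfield p z]" for z
    using pure[of z "lfield p z"] by (simp add: Jp)
  have "vector [0, 0, - c] = - (vector [0, 0, c] :: complex ^ 3)" by (simp add: vec_eq_iff forall_3)
  then have neg: "\<alpha> z [vector [0, 0, - c]] = - \<alpha> z [vector [0, 0, c]]" for z
    using linear_neg[OF forms_linear_degree_1[OF forms]] by simp
  show ?thesis
  proof (cases "\<kappa> = \<i>")
    case True
    show ?thesis
      by (rule closed_form_vanishes[OF forms closed refl[of "vector [0, 0, c]"]]) (simp add: q True)
  next
    case False
    then have "\<kappa> = - \<i>" using \<kappa> by auto
    then show ?thesis
      by (intro closed_form_vanishes[OF forms closed refl[of "vector [0, 0, - c]"]]) (simp add: neg q)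
  qed
qed

text \<open>
  Evaluated on the direction \<open>p\<close>, the identity leaves \<open>sin (\<pi> t)\<close> as the derivative of a bounded function
  along a one-parameter subgroup; that function would grow linearly.
\<close>

lemma e3_not_sum_of_pure:
  assumes t: "0 < t" "t < 1"
    and F: "finite F" "\<And>i. i \<in> F \<Longrightarrow> \<alpha> i \<in> pure_closed_1 iwasawa_deck J"
    and \<beta>: "bounded_primitive \<beta>"
    and sum: "\<And>x vs. real_1_form (e 3) x vs = (\<Sum>i\<in>F. \<alpha> i x vs) + \<beta> x vs"
  shows False
proof -
  obtain p c where Jp: "\<And>z. blinfun_apply (J z) (lfield p z) = vector [0, 0, c]"
    and e3: "\<And>z. blinfun_apply (e 3 z) (lfield p z) = sin (pi * t)"
    using central_direction by metis
  have \<beta>p: "\<beta> z [lfield p z] = of_real (sin (pi * t))" for z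
    using sum[of z "[lfield p z]"] pure_closed_vanishes[OF Jp F(2)]
    by (simp add: real_1_form_def covector_form_def e3)
  have s: "sin (pi * t) > 0" using t by (intro sin_gt_zero) auto
  obtain g where "bounded (range g)" and g: "\<And>x. (g has_derivative (\<lambda>v. \<beta> x [v])) (at x)"
    using \<beta> unfolding bounded_primitive_def by blast
  then obtain B where B: "\<And>x. norm (g x) \<le> B" unfolding bounded_iff by auto
  define \<gamma> where "\<gamma> r = heis_mult 0 (heis_exp p r)" for r
  have "((\<lambda>r. g (\<gamma> r)) has_derivative (\<lambda>h. \<beta> (\<gamma> r) [h *\<^sub>R lfield p (\<gamma> r)])) (at r)" for r
    unfolding \<gamma>_def by (rule has_derivative_compose[OF has_derivative_heis_exp g])
  moreover have "\<beta> x [h *\<^sub>R lfield p x] = h *\<^sub>R of_real (sin (pi * t))" for x h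
    using linear_cmul[OF has_derivative_linear[OF g]] by (simp add: \<beta>p)
  ultimately have "((\<lambda>r. g (\<gamma> r) - r *\<^sub>R of_real (sin (pi * t))) has_derivative (\<lambda>h. 0)) (at r within UNIV)" for r
    by (auto intro!: derivative_eq_intros)
  then have "\<exists>d. \<forall>r\<in>UNIV. g (\<gamma> r) - r *\<^sub>R of_real (sin (pi * t)) = d"
    by (intro has_derivative_zero_constant) auto
  then obtain d where d: "g (\<gamma> r) - r *\<^sub>R of_real (sin (pi * t)) = d" for r by blast
  define r where "r = (2 * \<bar>B\<bar> + 1) / sin (pi * t)"
  have "r *\<^sub>R of_real (sin (pi * t)) = g (\<gamma> r) - g (\<gamma> 0)"
    using d[of r] d[of 0] by (simp add: algebra_simps)
  then have "norm (r *\<^sub>R of_real (sin (pi * t)) :: complex) \<le> B + B"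
    using B[of "\<gamma> r"] B[of "\<gamma> 0"] norm_triangle_ineq4[of "g (\<gamma> r)" "g (\<gamma> 0)"] by simp
  then have "\<bar>r * sin (pi * t)\<bar> \<le> B + B" by (simp add: norm_mult abs_mult)
  moreover have "r * sin (pi * t) = 2 * \<bar>B\<bar> + 1" using s by (simp add: r_def)
  ultimately show False by linarith
qed

end

section \<open>Failure of fullness\<close>

theorem mainTheorem8:
  fixes e :: "nat \<Rightarrow> complex ^ 3 \<Rightarrow> (complex ^ 3) \<Rightarrow>\<^sub>L real"
    and J :: "real \<Rightarrow> complex ^ 3 \<Rightarrow> (complex ^ 3) \<Rightarrow>\<^sub>L (complex ^ 3)"
  assumes "left_invariant_coframe e"
    and "iwasawa_structure_equations e"
    and "\<And>t. t \<in> {0..1} \<Longrightarrow> almost_complex iwasawa_deck (J t)"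
    and "\<And>t. t \<in> {0..1} \<Longrightarrow> equivariant left_translations (J t)"
    and "\<And>t x. t \<in> {0..1} \<Longrightarrow>
           covectors_10 (J t x) = cspan {phi1 e t x, phi2 e t x, phi3 e t x}"
  shows "\<forall>t\<in>{0<..<1}.
           \<not> complex_C_infinity_full iwasawa_deck (J t) 1 \<and>
           \<not> gen_C_infinity_pure_and_full iwasawa_deck (gen_of_complex (J t))"
proof
  fix t :: real assume t: "t \<in> {0<..<1}"
  interpret iwasawa_path e "J t" t
    by unfold_locales (use assms t in auto)
  note e3_closed = real_1_form_coframe_closed[OF coframe _ closed_1234, of 3]
  have not_sum: False
    if mem: "coh_class B (real_1_form (e 3)) \<in> sum_of_subspaces B I W" and zero: "(\<lambda>x vs. 0) \<in> B"
      and B: "B \<subseteq> exact_forms iwasawa_deck"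
      and W: "\<And>i. i \<in> I \<Longrightarrow> W i \<subseteq> coh_class B ` pure_closed_1 iwasawa_deck (J t)"
    for B and I :: "'i set" and W
  proof -
    have prim: "bounded_primitive \<beta>" if "\<beta> \<in> B" for \<beta>
      using that B by (intro bounded_primitive_exact) auto
    show False
    proof (rule sum_of_subspaces_representatives[OF mem zero prim W])
      fix F :: "'i set" and \<alpha> \<beta>
      assume repr: "finite F" "\<And>i. i \<in> F \<Longrightarrow> \<alpha> i \<in> pure_closed_1 iwasawa_deck (J t)" "bounded_primitive \<beta>"
        "\<And>x vs. real_1_form (e 3) x vs = (\<Sum>i\<in>F. \<alpha> i x vs) + \<beta> x vs"
      show False by (rule e3_not_sum_of_pure[OF _ _ repr]) (use t in auto)
    qed
  qed
  have "\<not> complex_C_infinity_full iwasawa_deck (J t) 1"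
  proof
    assume "complex_C_infinity_full iwasawa_deck (J t) 1"
    then have "coh_class (exact_k_forms iwasawa_deck 1) (real_1_form (e 3))
        \<in> sum_of_subspaces (exact_k_forms iwasawa_deck 1) {(p, q). p + q = 1}
            (\<lambda>(p, q). H_pq iwasawa_deck (J t) p q)"
      using e3_closed unfolding complex_C_infinity_full_def H_dR_def by simp
    then show False
    proof (rule not_sum[OF _ zero_in_exact_forms(1) exact_1_forms_subset])
      fix i :: "nat \<times> nat"
      assume "i \<in> {(p, q). p + q = 1}"
      then show "(case i of (p, q) \<Rightarrow> H_pq iwasawa_deck (J t) p q)
          \<subseteq> coh_class (exact_k_forms iwasawa_deck 1) ` pure_closed_1 iwasawa_deck (J t)"
        by (simp only: case_prod_beta mem_Collect_eq H_pq_pure)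
    qed
  qed
  moreover have "\<not> gen_C_infinity_pure_and_full iwasawa_deck (gen_of_complex (J t))"
  proof
    assume "gen_C_infinity_pure_and_full iwasawa_deck (gen_of_complex (J t))"
    then have "coh_class (exact_forms iwasawa_deck) (real_1_form (e 3))
        \<in> sum_of_subspaces (exact_forms iwasawa_deck) UNIV
            (GH_k iwasawa_deck (gen_of_complex (J t)))"
      using e3_closed unfolding gen_C_infinity_pure_and_full_def GH_dR_def by simp
    then show False
      by (rule not_sum[OF _ zero_in_exact_forms(2) order_refl GH_k_pure])
  qed
  ultimately show "\<not> complex_C_infinity_full iwasawa_deck (J t) 1 \<and>
      \<not> gen_C_infinity_pure_and_full iwasawa_deck (gen_of_complex (J t))" by blast
qed

end
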